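(* Let $G=\mathbb{Z}_{p^2}\times\mathbb{Z}_q$ for distinct primes $p$ and $q$, let $S$ be a proper subset of $G\setminus\{0\}$ that generates $G$, and let $S_0=S\cup\{0\}$. Let $0\in C\subseteq G$. Then $C$ is a perfect code in $\mathrm{Cay}(G,S)$ if and only if, for some integer parameters, $(S_0,C)$ is one of the following pairs: (1) $S_0=\{(i+\alpha_ip,\alpha_i)\mid i\in[p]\}$, $C=\{(ip,j)\mid i\in[p],j\in[q]\}$; (2) $S_0=\{(\alpha_i,i)\mid i\in[q]\}$, $C=\{(i,0)\mid i\in[p^2]\}$; (3) $S_0=\{(i+jp,\alpha_i)\mid i,j\in[p]\}$, $C=\{(\lambda_ip,i)\mid i\in[q]\}$; (4) $S_0=\{(i,\alpha_i)\mid i\in[p^2]\}$, $C=\{(0,i)\mid i\in[q]\}$; (5) $S_0=\{(i+\alpha_ip,j)\mid i\in[p],j\in[q]\}$, $C=\{(ip,\lambda_i)\mid i\in[p]\}$; (6) $S_0=\{(\alpha_i+jp,i)\mid i\in[q],j\in[p]\}$, $C=\{(i+\lambda_ip,0)\mid i\in[p]\}$; (7) $S_0=\{(i+\alpha_{ij}p,j)\mid i\in[p],j\in[q]\}$, $C=\{(ip,0)\mid i\in[p]\}$.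
   Context: Groups are finite abelian, written additively; $\mathbb{Z}_n$ is the group of integers modulo $n$ and $[n]=\{0,1,\dots,n-1\}$; integers in coordinates are read modulo the relevant modulus. For $S\subseteq G\setminus\{0\}$, $\mathrm{Cay}(G,S)$ is the directed graph with vertex set $G$ and an arc from $x$ to $y$ if and only if $y-x\in S$ ($S$ is not assumed to be inverse-closed). A subset $C\subseteq G$ is a perfect code in $\mathrm{Cay}(G,S)$ if the sets $\{c\}\cup\{v:\text{there is an arc from } c \text{ to } v\}$, $c\in C$, form a partition of $G$. Greek letters with subscripts denote arbitrary integers, one for each value of the displayed indices, subject only to being $0$ when all subscripts are $0$; different letters (or index patterns) denote independent families, and an integer occurring several times in one element is the same integer each time. *)

theory Defs
  imports
    "HOL-Algebra.Elementary_Groups"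
    "HOL-Algebra.Generated_Groups"
    "HOL-Library.Disjoint_Sets"
    "HOL-Computational_Algebra.Primes"
    "Graph_Theory.Pair_Digraph"
begin

text \<open>HOL-Algebra groups are written multiplicatively, so \<open>y - x\<close> reads \<open>y \<otimes> inv x\<close>.\<close>

definition Cay :: "('a, 'm) monoid_scheme \<Rightarrow> 'a set \<Rightarrow> 'a pair_pre_digraph" where
  "Cay G S =
     \<lparr> pverts = carrier G,
       parcs = {(x, y). x \<in> carrier G \<and> y \<in> carrier G \<and> y \<otimes>\<^bsub>G\<^esub> inv\<^bsub>G\<^esub> x \<in> S} \<rparr>"

definition closed_out_nbhd :: "('a, 'b) pre_digraph \<Rightarrow> 'a \<Rightarrow> 'a set" where
  "closed_out_nbhd D c = insert c {v. c \<rightarrow>\<^bsub>D\<^esub> v}"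

text \<open>The blocks of the partition form a family indexed by the code: distinct codewords
  must have disjoint (in particular different) closed out-neighbourhoods.\<close>

definition perfect_code :: "('a, 'b) pre_digraph \<Rightarrow> 'a set \<Rightarrow> bool" where
  "perfect_code D C \<longleftrightarrow>
     C \<subseteq> verts D \<and>
     disjoint_family_on (closed_out_nbhd D) C \<and>
     (\<Union>c\<in>C. closed_out_nbhd D c) = verts D"

definition ZxZ :: "nat \<Rightarrow> nat \<Rightarrow> (int \<times> int) monoid" where
  "ZxZ m n = integer_mod_group m \<times>\<times> integer_mod_group n"

text \<open>For \<open>n > 0\<close> the carrier of \<^term>\<open>integer_mod_group n\<close> consists of the representatives
  \<open>0, \<dots>, n - 1\<close>; \<open>residue_pair m n x y\<close> is the element of \<^term>\<open>ZxZ m n\<close> written \<open>(x, y)\<close> with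
  arbitrary integers \<open>x\<close>, \<open>y\<close>.\<close>

definition residue_pair :: "nat \<Rightarrow> nat \<Rightarrow> int \<Rightarrow> int \<Rightarrow> int \<times> int" where
  "residue_pair m n x y = (x mod int m, y mod int n)"

end

theory Submission
  imports Defs "HOL-Library.Poly_Mapping" "HOL-Library.Product_Plus" "HOL-Number_Theory.Cong"
begin

text \<open>
  A perfect code in \<open>Cay(G, S)\<close> is a factorization \<open>G = A + C\<close> with \<open>A = S \<union> {0}\<close>: every element is
  \<open>a + c\<close> in exactly one way.  Equivalently, \<open>|A| |C| = |G|\<close> and no nonzero difference of \<open>A\<close> is a
  difference of \<open>C\<close>.

  The lever is a multiplier principle: if \<open>k\<close> is coprime to \<open>|A|\<close>, then \<open>G = k A + C\<close> as well
  (lemma \<open>factorization_nat_mult\<close>).  It suffices to treat a prime \<open>k = r\<close>.  In the integral group ring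
  let \<open>F\<close> and \<open>E\<close> be the sums of the elements of \<open>A\<close> and \<open>C\<close>.  Modulo \<open>r\<close>, the power \<open>F\<^sup>r\<close> is the sum of
  the elements \<open>r a\<close>, while \<open>F E\<close> is the sum of all elements of \<open>G\<close>, so
  \<open>F\<^sup>r E = |A|\<^bsup>r-1\<^esup> F E\<close>.  Hence the number of representations \<open>g = r a + c\<close> is congruent to
  \<open>|A|\<^bsup>r-1\<^esup>\<close>, which is nonzero modulo \<open>r\<close>; so every \<open>g\<close> is represented, and by counting exactly once.

  Combined with the Chinese remainder theorem (lemma \<open>multiplier\<close>), this allows the first coordinates
  of the differences of \<open>A\<close> to be multiplied by \<open>c\<close> and the second ones independently by \<open>d\<close>, where
  \<open>c\<close> has to be prime to \<open>p\<close> only if \<open>p\<close> divides \<open>|A|\<close>, and \<open>d\<close> prime to \<open>q\<close> only if \<open>q\<close> divides \<open>|A|\<close>.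
  One difference of \<open>A\<close> therefore excludes a whole class of differences of \<open>C\<close>.

  Since \<open>S\<close> generates \<open>G\<close>, the set \<open>A\<close> has a difference whose first coordinate is prime to \<open>p\<close> and whose
  second coordinate is nonzero; call such a set generic.  The order of \<open>A\<close> is one of
  \<open>p, q, p\<^sup>2, p q\<close>.  Let \<open>P\<close> be the subgroup of order \<open>p\<close>.
  If \<open>|A| = p\<close>, genericity puts \<open>C\<close> inside the subgroup of order \<open>p q\<close>; if \<open>|A| = q\<close>, it puts \<open>C\<close> inside
  the subgroup of order \<open>p\<^sup>2\<close>.  If \<open>|A| = p\<^sup>2\<close>, the first coordinates of \<open>C\<close> are divisible by \<open>p\<close>, and
  unless all of them are zero a nonzero one makes the second coordinate on \<open>A\<close> depend only on the
  first one modulo \<open>p\<close>.  If \<open>|A| = p q\<close>, the multipliers act on \<open>C\<close>: a generic \<open>C\<close> would contradict the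
  genericity of \<open>A\<close>, so \<open>C\<close> lies in \<open>\<int>\<^bsub>p\<^sup>2\<^esub> \<times> {0}\<close> or in \<open>P \<times> \<int>\<^sub>q\<close>, and the possible shapes of \<open>A\<close> are
  read off from the excluded differences.  In each case an inclusion into the parametrized set is
  enough, because the parametrized set has at most as many elements.  Conversely each listed pair covers
  \<open>G\<close>, and has few enough elements to cover it only once.
\<close>

section \<open>Freshman's dream and natural multiples\<close>

definition nat_mult :: "nat \<Rightarrow> 'a::comm_monoid_add \<Rightarrow> 'a" where
  "nat_mult k a = (\<Sum>_<k. a)"

lemma nat_mult_0 [simp]: "nat_mult 0 a = 0"
  and nat_mult_Suc: "nat_mult (Suc k) a = nat_mult k a + a"
  by (simp_all add: nat_mult_def)

lemma nat_mult_1 [simp]: "nat_mult (Suc 0) a = a"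
  by (simp add: nat_mult_Suc)

lemma nat_mult_add: "nat_mult (k + l) a = nat_mult k a + nat_mult l a"
  by (induction l) (simp_all add: nat_mult_Suc add.assoc)

lemma nat_mult_mult: "nat_mult (k * l) a = nat_mult k (nat_mult l a)"
  by (induction k) (simp_all add: nat_mult_Suc nat_mult_add add.commute)

lemma nat_mult_Pair: "nat_mult k (x :: int, y :: int) = (int k * x, int k * y)"
  by (induction k) (simp_all add: nat_mult_Suc zero_prod_def algebra_simps)

text \<open>The binomial coefficients \<open>r choose k\<close> with \<open>0 < k < r\<close> are divisible by \<open>r\<close>, so raising to the power \<open>r\<close>
  is additive modulo \<open>r\<close>.  The ring has characteristic zero in the application, hence the
  formulation by divisibility.\<close>

lemma prime_dvd_power_sum_diff:
  fixes f :: "'i \<Rightarrow> 'a :: comm_ring_1"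
  assumes r: "prime r" and "finite I"
  shows "of_nat r dvd (\<Sum>i\<in>I. f i) ^ r - (\<Sum>i\<in>I. f i ^ r)"
  using \<open>finite I\<close>
proof (induction I rule: finite_induct)
  case empty
  then show ?case using prime_gt_0_nat[OF r] by (simp add: power_0_left)
next
  case (insert j I)
  have binary: "of_nat r dvd (x + y) ^ r - (x ^ r + y ^ r)" for x y :: 'a
  proof -
    have "{..r} = insert 0 (insert r {0<..<r})" using prime_gt_0_nat[OF r] by auto
    then have "(x + y) ^ r - (x ^ r + y ^ r)
        = (\<Sum>k\<in>{0<..<r}. of_nat (r choose k) * x ^ k * y ^ (r - k))"
      using prime_gt_0_nat[OF r] by (simp add: binomial_ring)
    also have "of_nat r dvd \<dots>"
    proof (rule dvd_sum)
      fix k assume "k \<in> {0<..<r}"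
      then have "r dvd (r choose k)" using r by (intro dvd_choose_prime) auto
      then have "of_nat r dvd (of_nat (r choose k) :: 'a)" by (auto simp: dvd_def)
      then show "of_nat r dvd of_nat (r choose k) * x ^ k * y ^ (r - k)"
        by (simp add: mult.assoc)
    qed
    finally show ?thesis .
  qed
  have "(\<Sum>i\<in>insert j I. f i) ^ r - (\<Sum>i\<in>insert j I. f i ^ r)
     = ((f j + (\<Sum>i\<in>I. f i)) ^ r - (f j ^ r + (\<Sum>i\<in>I. f i) ^ r))
       + ((\<Sum>i\<in>I. f i) ^ r - (\<Sum>i\<in>I. f i ^ r))"
    using insert.hyps by simp
  then show ?case using binary insert.IH by (metis dvd_add)
qed

section \<open>Multipliers of factorizations of abelian groups\<close>

text \<open>A quotient group is represented by a map whose fibres are the cosets of a subgroup, such as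
  reduction of integers.  Computing with representatives keeps the type class arithmetic, in
  particular the group ring \<open>'a \<Rightarrow>\<^sub>0 int\<close>.\<close>

locale coset_map =
  fixes \<pi> :: "'a :: ab_group_add \<Rightarrow> 'b"
  assumes eq_iff: "\<pi> x = \<pi> y \<longleftrightarrow> \<pi> (x - y) = \<pi> 0"
begin

lemma eq_diff: "\<pi> (a + b) = \<pi> x \<longleftrightarrow> \<pi> b = \<pi> (x - a)"
  using eq_iff[of "a + b" x] eq_iff[of b "x - a"] by (simp add: algebra_simps)

text \<open>The coefficient of the coset of \<open>x\<close> in the image of \<open>F\<close> in the group ring of the quotient.\<close>

definition fibre_sum :: "'a \<Rightarrow> ('a \<Rightarrow>\<^sub>0 int) \<Rightarrow> int" where
  "fibre_sum x F = (\<Sum>h \<in> Poly_Mapping.keys F. if \<pi> h = \<pi> x then Poly_Mapping.lookup F h else 0)"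

lemma fibre_sum_superset:
  assumes "finite K" "Poly_Mapping.keys F \<subseteq> K"
  shows "fibre_sum x F = (\<Sum>h\<in>K. if \<pi> h = \<pi> x then Poly_Mapping.lookup F h else 0)"
  unfolding fibre_sum_def using assms
  by (intro sum.mono_neutral_left) (auto simp: in_keys_iff)

lemma fibre_sum_0 [simp]: "fibre_sum x 0 = 0"
  by (simp add: fibre_sum_def)

lemma fibre_sum_add: "fibre_sum x (F + H) = fibre_sum x F + fibre_sum x H"
proof -
  let ?K = "Poly_Mapping.keys F \<union> Poly_Mapping.keys H"
  have "fibre_sum x (F + H) = (\<Sum>h\<in>?K. if \<pi> h = \<pi> x then Poly_Mapping.lookup (F + H) h else 0)"
    by (rule fibre_sum_superset) (use Poly_Mapping.keys_add[of F H] in auto)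
  also have "\<dots> = (\<Sum>h\<in>?K. if \<pi> h = \<pi> x then Poly_Mapping.lookup F h else 0)
      + (\<Sum>h\<in>?K. if \<pi> h = \<pi> x then Poly_Mapping.lookup H h else 0)"
    unfolding sum.distrib[symmetric] by (rule sum.cong) (auto simp: lookup_add)
  also have "\<dots> = fibre_sum x F + fibre_sum x H"
    using fibre_sum_superset[of ?K F x] fibre_sum_superset[of ?K H x] by simp
  finally show ?thesis .
qed

lemma fibre_sum_sum: "fibre_sum x (\<Sum>i\<in>I. F i) = (\<Sum>i\<in>I. fibre_sum x (F i))"
  by (induction I rule: infinite_finite_induct) (simp_all add: fibre_sum_add)

lemma fibre_sum_of_nat_mult: "fibre_sum x (of_nat r * F) = int r * fibre_sum x F"
  by (induction r) (simp_all add: fibre_sum_add algebra_simps)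

lemma fibre_sum_single [simp]:
  "fibre_sum x (Poly_Mapping.single a c) = (if \<pi> a = \<pi> x then c else 0)"
  by (simp add: fibre_sum_def)

lemma fibre_sum_shift:
  "fibre_sum x (Poly_Mapping.single a 1 * H) = fibre_sum (x - a) H"
proof -
  have H: "H = (\<Sum>b\<in>Poly_Mapping.keys H. Poly_Mapping.single b (Poly_Mapping.lookup H b))"
    by (rule poly_mapping_eqI) (auto simp: lookup_sum lookup_single when_def in_keys_iff)
  show ?thesis
    by (subst (1 2) H) (simp only: sum_distrib_left fibre_sum_sum mult_single fibre_sum_single eq_diff mult_1)
qed

definition factorization :: "'i set \<Rightarrow> ('i \<Rightarrow> 'a) \<Rightarrow> 'j set \<Rightarrow> ('j \<Rightarrow> 'a) \<Rightarrow> bool" where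
  "factorization I f J g \<longleftrightarrow> bij_betw (\<lambda>(i, j). \<pi> (f i + g j)) (I \<times> J) (range \<pi>)"

definition formal_sum :: "'i set \<Rightarrow> ('i \<Rightarrow> 'a) \<Rightarrow> 'a \<Rightarrow>\<^sub>0 int" where
  "formal_sum I f = (\<Sum>i\<in>I. Poly_Mapping.single (f i) 1)"

lemma fibre_sum_formal_sum_mult:
  "fibre_sum x (formal_sum I f * H) = (\<Sum>i\<in>I. fibre_sum (x - f i) H)"
  by (simp add: formal_sum_def sum_distrib_right fibre_sum_sum fibre_sum_shift)

lemma fibre_sum_product:
  assumes "finite I" "finite J"
  shows "fibre_sum x (formal_sum I f * formal_sum J g)
    = int (card {(i, j) \<in> I \<times> J. \<pi> (f i + g j) = \<pi> x})"
proof -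
  have "fibre_sum x (formal_sum I f * formal_sum J g)
      = (\<Sum>i\<in>I. \<Sum>j\<in>J. if \<pi> (f i + g j) = \<pi> x then 1 else 0)"
    unfolding fibre_sum_formal_sum_mult
    by (simp add: formal_sum_def fibre_sum_sum eq_diff)
  also have "\<dots> = (\<Sum>z\<in>I \<times> J. if (case z of (i, j) \<Rightarrow> \<pi> (f i + g j) = \<pi> x) then 1 else 0)"
    by (simp add: sum.cartesian_product case_prod_unfold)
  also have "\<dots> = int (card {z \<in> I \<times> J. case z of (i, j) \<Rightarrow> \<pi> (f i + g j) = \<pi> x})"
    using assms by (subst sum.If_cases) (auto simp: Int_def)
  finally show ?thesis by (simp add: case_prod_unfold mem_Times_iff conj_assoc)
qed

lemma single_power:
  "Poly_Mapping.single (a :: 'a) (1 :: int) ^ r = Poly_Mapping.single (nat_mult r a) 1"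
  by (induction r) (simp_all add: nat_mult_Suc mult_single add.commute)

text \<open>A surjection from a finite set onto one that is at least as large is injective.\<close>

lemma factorizationI_card:
  assumes "finite I" "finite J" and "card I * card J \<le> card (range \<pi>)"
    and "\<And>x. \<exists>i\<in>I. \<exists>j\<in>J. \<pi> (f i + g j) = \<pi> x"
  shows "factorization I f J g"
proof -
  let ?h = "\<lambda>(i, j). \<pi> (f i + g j)"
  have img: "?h ` (I \<times> J) = range \<pi>"
  proof
    show "range \<pi> \<subseteq> ?h ` (I \<times> J)"
    proof
      fix y assume "y \<in> range \<pi>"
      then obtain i j where "i \<in> I" "j \<in> J" "y = \<pi> (f i + g j)" using assms(4) by (metis rangeE)
      then show "y \<in> ?h ` (I \<times> J)" by force
    qed
  qed auto
  moreover have "inj_on ?h (I \<times> J)"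
    using assms(1-3) img card_image_le[of "I \<times> J" ?h]
    by (intro eq_card_imp_inj_on) (auto simp: card_cartesian_product)
  ultimately show ?thesis by (simp add: factorization_def bij_betw_def)
qed

text \<open>The number of representations of the coset of \<open>x\<close> by the multiplied family is congruent to
  \<open>|I|\<^bsup>r-1\<^esup>\<close> modulo \<open>r\<close> and hence not zero.\<close>

lemma factorization_nat_mult_prime:
  assumes fact: "factorization I f J g" and fin: "finite I" "finite J"
    and r: "prime r" "\<not> r dvd card I"
  shows "factorization I (\<lambda>i. nat_mult r (f i)) J g"
proof (rule factorizationI_card)
  let ?F = "formal_sum I f" and ?E = "formal_sum J g"
  from fact have bij: "bij_betw (\<lambda>(i, j). \<pi> (f i + g j)) (I \<times> J) (range \<pi>)"
    by (simp add: factorization_def)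
  show "card I * card J \<le> card (range \<pi>)"
    using bij_betw_same_card[OF bij] by (simp add: card_cartesian_product)
  fix x
  \<comment> \<open>In the quotient, \<open>F E\<close> is the sum of all group elements, which every further factor \<open>F\<close> multiplies by \<open>|I|\<close>.\<close>
  have one: "fibre_sum y (?F * ?E) = 1" for y
  proof -
    from bij have "\<pi> y \<in> (\<lambda>(i, j). \<pi> (f i + g j)) ` (I \<times> J)"
      by (simp add: bij_betw_def)
    then obtain i j where ij: "i \<in> I" "j \<in> J" "\<pi> (f i + g j) = \<pi> y" by auto
    have "{(i, j) \<in> I \<times> J. \<pi> (f i + g j) = \<pi> y} = {(i, j)}"
      using ij inj_onD[OF bij_betw_imp_inj_on[OF bij], of _ "(i, j)"] by auto
    then show ?thesis unfolding fibre_sum_product[OF fin] by simp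
  qed
  have pow: "fibre_sum y (?F ^ n * (?F * ?E)) = int (card I) ^ n" for n y
  proof (induction n arbitrary: y)
    case (Suc n)
    then show ?case
      unfolding power_Suc mult.assoc fibre_sum_formal_sum_mult[of y I f "?F ^ n * (?F * ?E)"] by simp
  qed (simp add: one)
  let ?F' = "formal_sum I (\<lambda>i. nat_mult r (f i))"
  have "of_nat r dvd ?F ^ r - ?F'"
    using prime_dvd_power_sum_diff[OF r(1) fin(1), of "\<lambda>i. Poly_Mapping.single (f i) (1 :: int)"]
    by (simp add: formal_sum_def single_power)
  then obtain Q where "?F ^ r = ?F' + of_nat r * Q" by (metis dvdE diff_eq_eq add.commute)
  moreover have "?F ^ r * ?E = ?F ^ (r - 1) * (?F * ?E)"
    using prime_gt_0_nat[OF r(1)] by (metis mult.assoc power_minus_mult)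
  ultimately have "fibre_sum x (?F ^ (r - 1) * (?F * ?E)) = fibre_sum x (?F' * ?E + of_nat r * (Q * ?E))"
    by (simp add: algebra_simps)
  then have "int (card I) ^ (r - 1) = fibre_sum x (?F' * ?E) + int r * fibre_sum x (Q * ?E)"
    by (simp add: pow fibre_sum_add fibre_sum_of_nat_mult)
  moreover have "\<not> int r dvd int (card I) ^ (r - 1)"
    using r by (metis int_dvd_int_iff of_nat_power prime_dvd_power_nat)
  ultimately have "fibre_sum x (?F' * ?E) \<noteq> 0" by auto
  then have "{(i, j) \<in> I \<times> J. \<pi> (nat_mult r (f i) + g j) = \<pi> x} \<noteq> {}"
    unfolding fibre_sum_product[OF fin] by (metis card.empty of_nat_0)
  then show "\<exists>i\<in>I. \<exists>j\<in>J. \<pi> (nat_mult r (f i) + g j) = \<pi> x" by auto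
qed (use fin in auto)

lemma factorization_nat_mult:
  assumes "factorization I f J g" "finite I" "finite J" and "coprime k (card I)" "k > 0"
  shows "factorization I (\<lambda>i. nat_mult k (f i)) J g"
  using assms(4,5)
proof (induction k rule: prime_divisors_induct)
  case (factor r k)
  then show ?case
    using factorization_nat_mult_prime[of I "\<lambda>i. nat_mult k (f i)" J g r] assms(2,3)
    by (auto simp: nat_mult_mult) (metis coprime_mult_left_iff not_prime_unit coprime_absorb_left)
qed (use assms(1) in auto)

end

section \<open>Congruences modulo prime powers\<close>

lemma prime_multiplier_ex:
  fixes s t :: int
  assumes r: "prime (r :: nat)" and s: "\<not> int r dvd s" and "k > 0"
  shows "\<exists>c. [c * s = t] (mod int r ^ k) \<and> (\<not> int r dvd t \<longrightarrow> \<not> int r dvd c)"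
proof -
  have "coprime s (int r ^ k)"
    using r s by (simp add: coprime_commute[of s] prime_imp_coprime)
  then obtain e where e: "[s * e = 1] (mod int r ^ k)" using cong_solve_coprime_int by blast
  have c: "[t * e * s = t] (mod int r ^ k)"
    using cong_scalar_left[OF e, of t] by (simp add: ac_simps)
  then have "[t * e * s = t] (mod int r)"
    using \<open>k > 0\<close> by (meson cong_dvd_modulus dvd_power)
  then have "int r dvd t * e \<Longrightarrow> int r dvd t" by (meson cong_dvd_iff dvd_mult2)
  with c show ?thesis by blast
qed

text \<open>Two elements of the subgroup of order \<open>r\<close> in the integers modulo \<open>r\<^sup>2\<close> that are nonzero differ
  by a unit factor.\<close>

lemma prime_multiplier_square_ex:
  fixes s t :: int
  assumes r: "prime (r :: nat)" and "int r dvd s" "int r dvd t"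
    and "\<not> int r ^ 2 dvd s" "\<not> int r ^ 2 dvd t"
  shows "\<exists>c. [c * s = t] (mod int r ^ 2) \<and> \<not> int r dvd c"
proof -
  obtain s' t' where st: "s = int r * s'" "t = int r * t'" using assms(2,3) by (auto elim!: dvdE)
  have "\<not> int r dvd s'" "\<not> int r dvd t'" using assms(4,5) st by (auto simp: power2_eq_square)
  then obtain c where c: "[c * s' = t'] (mod int r)" "\<not> int r dvd c"
    using prime_multiplier_ex[OF r, of s' 1 t'] by auto
  have "[int r * (c * s') = int r * t'] (mod int r * int r)"
    using c(1) by (simp add: cong_iff_dvd_diff flip: right_diff_distrib)
  then show ?thesis using c(2) st by (auto simp: power2_eq_square ac_simps)
qed

lemma residues_dvd_diff_iff:
  fixes x y :: int
  assumes "x \<in> {0..<int m}" "y \<in> {0..<int m}"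
  shows "int m dvd x - y \<longleftrightarrow> x = y"
  using assms by (auto simp: mod_eq_dvd_iff[symmetric])

section \<open>Sets given by a parametrization\<close>

lemma family_finite_card_le:
  "finite {f i |i. i < m}" "card {f i |i. i < (m :: nat)} \<le> m"
proof -
  have "{f i |i. i < m} = f ` {..<m}" by auto
  then show "finite {f i |i. i < m}" "card {f i |i. i < m} \<le> m"
    using card_image_le[of "{..<m}" f] by auto
qed

lemma family2_finite_card_le:
  "finite {f i j |i j. i < m \<and> j < n}" "card {f i j |i j. i < (m :: nat) \<and> j < (n :: nat)} \<le> m * n"
proof -
  have "{f i j |i j. i < m \<and> j < n} = case_prod f ` ({..<m} \<times> {..<n})" by auto
  then show "finite {f i j |i j. i < m \<and> j < n}" "card {f i j |i j. i < m \<and> j < n} \<le> m * n"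
    using card_image_le[of "{..<m} \<times> {..<n}" "case_prod f"] by (auto simp: card_cartesian_product)
qed

text \<open>A set given by a parametrization has at most as many elements as there are parameters.  So for a set
  that is known to be large enough, inclusion in the parametrized set is equality.\<close>

lemma eq_familyI:
  "A \<subseteq> {f i |i. i < m} \<Longrightarrow> m \<le> card A \<Longrightarrow> A = {f i |i. i < (m :: nat)}"
  using family_finite_card_le[of f m] by (intro card_seteq) auto

lemma eq_family2I:
  "A \<subseteq> {f i j |i j. i < m \<and> j < n} \<Longrightarrow> m * n \<le> card A
    \<Longrightarrow> A = {f i j |i j. i < (m :: nat) \<and> j < (n :: nat)}"
  using family2_finite_card_le[of f m n] by (intro card_seteq) auto

section \<open>Perfect codes as factorizations\<close>

definition reduce :: "nat \<Rightarrow> nat \<Rightarrow> int \<times> int \<Rightarrow> int \<times> int" where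
  "reduce m n z = residue_pair m n (fst z) (snd z)"

lemma reduce_Pair: "reduce m n (x, y) = residue_pair m n x y"
  by (simp add: reduce_def)

lemma residue_pair_eq_iff:
  "residue_pair m n x y = residue_pair m n x' y' \<longleftrightarrow> [x = x'] (mod int m) \<and> [y = y'] (mod int n)"
  by (auto simp: residue_pair_def cong_def)

interpretation reduce: coset_map "reduce m n" for m n
  by unfold_locales
    (auto simp: reduce_def residue_pair_eq_iff zero_prod_def minus_prod_def cong_iff_dvd_diff)

lemma carrier_ZxZ: "m > 0 \<Longrightarrow> n > 0 \<Longrightarrow> carrier (ZxZ m n) = {0..<int m} \<times> {0..<int n}"
  by (simp add: ZxZ_def carrier_integer_mod_group)

lemma one_ZxZ: "\<one>\<^bsub>ZxZ m n\<^esub> = (0, 0)"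
  by (simp add: ZxZ_def)

lemma group_ZxZ: "group (ZxZ m n)"
  by (simp add: ZxZ_def DirProd_group)

lemma mult_ZxZ: "a \<otimes>\<^bsub>ZxZ m n\<^esub> b = reduce m n (a + b)"
  by (simp add: ZxZ_def mult_DirProd' reduce_def residue_pair_def)

lemma inv_ZxZ: "a \<in> carrier (ZxZ m n) \<Longrightarrow> inv\<^bsub>ZxZ m n\<^esub> a = reduce m n (- a)"
  unfolding ZxZ_def by (cases a) (auto simp: reduce_def residue_pair_def)

lemma reduce_id: "m > 0 \<Longrightarrow> n > 0 \<Longrightarrow> a \<in> carrier (ZxZ m n) \<Longrightarrow> reduce m n a = a"
  by (auto simp: carrier_ZxZ reduce_def residue_pair_def)

lemma reduce_in_carrier: "m > 0 \<Longrightarrow> n > 0 \<Longrightarrow> reduce m n a \<in> carrier (ZxZ m n)"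
  by (auto simp: carrier_ZxZ reduce_def residue_pair_def)

lemma range_reduce: "m > 0 \<Longrightarrow> n > 0 \<Longrightarrow> range (reduce m n) = carrier (ZxZ m n)"
proof (intro equalityI subsetI)
  fix a assume "m > 0" "n > 0" "a \<in> carrier (ZxZ m n)"
  then show "a \<in> range (reduce m n)" using reduce_id by (metis rangeI)
qed (auto simp: reduce_in_carrier)

text \<open>The closed out-neighbourhood of \<open>c\<close> is the translate \<open>c + (S \<union> {0})\<close>.  Pairwise disjointness of these
  translates is injectivity of addition on \<open>(S \<union> {0}) \<times> C\<close>, and covering is surjectivity.\<close>

lemma perfect_code_Cay_iff:
  assumes mn: "m > 0" "n > 0" and S: "S \<subseteq> carrier (ZxZ m n)" and C: "C \<subseteq> carrier (ZxZ m n)"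
  shows "perfect_code (with_proj (Cay (ZxZ m n) S)) C
    \<longleftrightarrow> reduce.factorization m n (S \<union> {\<one>\<^bsub>ZxZ m n\<^esub>}) (\<lambda>s. s) C (\<lambda>c. c)"
proof -
  let ?G = "ZxZ m n" let ?S0 = "S \<union> {\<one>\<^bsub>ZxZ m n\<^esub>}" let ?D = "with_proj (Cay ?G S)"
  interpret G: group ?G by (rule group_ZxZ)
  have nb: "closed_out_nbhd ?D c = (\<lambda>s. reduce m n (s + c)) ` ?S0" if c: "c \<in> carrier ?G" for c
  proof -
    have "closed_out_nbhd ?D c = insert c {v \<in> carrier ?G. v \<otimes>\<^bsub>?G\<^esub> inv\<^bsub>?G\<^esub> c \<in> S}"
      using c by (auto simp: closed_out_nbhd_def Cay_def)
    also have "{v \<in> carrier ?G. v \<otimes>\<^bsub>?G\<^esub> inv\<^bsub>?G\<^esub> c \<in> S} = (\<lambda>s. s \<otimes>\<^bsub>?G\<^esub> c) ` S"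
    proof (intro equalityI subsetI)
      fix v assume v: "v \<in> {v \<in> carrier ?G. v \<otimes>\<^bsub>?G\<^esub> inv\<^bsub>?G\<^esub> c \<in> S}"
      then have "v = v \<otimes>\<^bsub>?G\<^esub> inv\<^bsub>?G\<^esub> c \<otimes>\<^bsub>?G\<^esub> c" using c by (simp add: G.m_assoc)
      then show "v \<in> (\<lambda>s. s \<otimes>\<^bsub>?G\<^esub> c) ` S" using v by blast
    next
      fix v assume "v \<in> (\<lambda>s. s \<otimes>\<^bsub>?G\<^esub> c) ` S"
      then show "v \<in> {v \<in> carrier ?G. v \<otimes>\<^bsub>?G\<^esub> inv\<^bsub>?G\<^esub> c \<in> S}"
        using c S by (auto simp: G.m_assoc subset_iff)
    qed
    also have "insert c ((\<lambda>s. s \<otimes>\<^bsub>?G\<^esub> c) ` S) = (\<lambda>s. s \<otimes>\<^bsub>?G\<^esub> c) ` ?S0"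
      using c by auto
    finally show ?thesis by (simp add: mult_ZxZ)
  qed
  have inj: "inj_on (\<lambda>s. reduce m n (s + c)) ?S0" if c: "c \<in> carrier ?G" for c
  proof (rule inj_onI)
    fix s s' assume "s \<in> ?S0" "s' \<in> ?S0" "reduce m n (s + c) = reduce m n (s' + c)"
    then show "s = s'" using c S G.one_closed G.right_cancel[of c s s']
      unfolding mult_ZxZ by blast
  qed
  let ?h = "\<lambda>(s, c). reduce m n (s + c)"
  have img: "?h ` (?S0 \<times> C) = (\<Union>c\<in>C. closed_out_nbhd ?D c)"
    using nb C by (fastforce simp: image_iff)
  have disj: "inj_on ?h (?S0 \<times> C) \<longleftrightarrow> disjoint_family_on (closed_out_nbhd ?D) C"
  proof
    assume h: "inj_on ?h (?S0 \<times> C)"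
    show "disjoint_family_on (closed_out_nbhd ?D) C"
      unfolding disjoint_family_on_def
    proof (intro ballI impI)
      fix c c' assume cc: "c \<in> C" "c' \<in> C" "c \<noteq> c'"
      then have "c \<in> carrier ?G" "c' \<in> carrier ?G" using C by auto
      show "closed_out_nbhd ?D c \<inter> closed_out_nbhd ?D c' = {}"
        unfolding nb[OF \<open>c \<in> carrier ?G\<close>] nb[OF \<open>c' \<in> carrier ?G\<close>]
      proof (rule ccontr)
        assume "(\<lambda>s. reduce m n (s + c)) ` ?S0 \<inter> (\<lambda>s. reduce m n (s + c')) ` ?S0 \<noteq> {}"
        then obtain s s' where "s \<in> ?S0" "s' \<in> ?S0" "?h (s, c) = ?h (s', c')" by fastforce
        then show False using inj_onD[OF h, of "(s, c)" "(s', c')"] cc by auto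
      qed
    qed
  next
    assume d: "disjoint_family_on (closed_out_nbhd ?D) C"
    show "inj_on ?h (?S0 \<times> C)"
    proof (rule inj_onI, clarify)
      fix s c s' c' assume s: "s \<in> ?S0" "s' \<in> ?S0" and c: "c \<in> C" "c' \<in> C"
        and eq: "reduce m n (s + c) = reduce m n (s' + c')"
      have cG: "c \<in> carrier ?G" "c' \<in> carrier ?G" using C c by auto
      have "reduce m n (s + c) \<in> closed_out_nbhd ?D c \<inter> closed_out_nbhd ?D c'"
        unfolding nb[OF cG(1)] nb[OF cG(2)] using s eq by blast
      then have "c = c'" using d c by (auto simp: disjoint_family_on_def)
      then show "s = s' \<and> c = c'" using inj_onD[OF inj[OF cG(1)]] eq s by blast
    qed
  qed
  show ?thesis
    using C unfolding perfect_code_def reduce.factorization_def bij_betw_def img disj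
      range_reduce[OF mn] by (simp add: Cay_def)
qed

section \<open>Differences in tilings of the group\<close>

locale distinct_primes =
  fixes p q :: nat
  assumes p: "prime p" and q: "prime q" and pq: "p \<noteq> q"
begin

abbreviation G where "G \<equiv> ZxZ (p^2) q"
abbreviation el where "el \<equiv> residue_pair (p^2) q"

definition tiling :: "(int \<times> int) set \<Rightarrow> (int \<times> int) set \<Rightarrow> bool" where
  "tiling A B \<longleftrightarrow> A \<subseteq> carrier G \<and> B \<subseteq> carrier G
     \<and> reduce.factorization (p^2) q A (\<lambda>a. a) B (\<lambda>b. b)"

lemma pos [simp]: "p > 0" "q > 0" "p^2 > 0"
  using p q by (simp_all add: prime_gt_0_nat)

lemma carrier_G: "carrier G = {0..<int (p^2)} \<times> {0..<int q}"
  by (rule carrier_ZxZ) auto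

lemma card_G: "card (carrier G) = p^2 * q"
  unfolding carrier_G card_cartesian_product by (simp add: nat_power_eq flip: of_nat_power)

lemma finite_carrier_G: "finite (carrier G)"
  by (simp add: carrier_G)

lemma carrier_dvd_diff_iff:
  assumes "(x, y) \<in> carrier G" "(x', y') \<in> carrier G"
  shows "(int p)^2 dvd x - x' \<longleftrightarrow> x = x'" and "int q dvd y - y' \<longleftrightarrow> y = y'"
  using assms residues_dvd_diff_iff[of x "p^2" x'] residues_dvd_diff_iff[of y q y']
  by (auto simp: carrier_G)

lemma finite_tiles: "tiling A B \<Longrightarrow> finite A \<and> finite B"
  unfolding tiling_def using finite_subset[OF _ finite_carrier_G] by blast

lemma card_tiles:
  assumes "tiling A B"
  shows "card A * card B = p^2 * q"
proof -
  have "bij_betw (\<lambda>(a, b). reduce (p^2) q (a + b)) (A \<times> B) (carrier G)"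
    using assms by (simp add: tiling_def reduce.factorization_def range_reduce)
  from bij_betw_same_card[OF this] show ?thesis by (simp add: card_G card_cartesian_product)
qed

lemma tiling_sym: "tiling A B \<Longrightarrow> tiling B A"
proof -
  assume t: "tiling A B"
  have "bij_betw ((\<lambda>(a, b). reduce (p^2) q (a + b)) \<circ> prod.swap) (B \<times> A) (range (reduce (p^2) q))"
    using t by (intro bij_betw_trans[of _ _ "A \<times> B"])
      (auto simp: tiling_def reduce.factorization_def bij_betw_def inj_on_def)
  moreover have "(\<lambda>(a, b). reduce (p^2) q (a + b)) \<circ> prod.swap = (\<lambda>(a, b). reduce (p^2) q (a + b))"
    by (auto simp: fun_eq_iff add.commute)
  ultimately show "tiling B A" using t by (simp add: tiling_def reduce.factorization_def)
qed

lemma tilingI: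
  assumes "A \<subseteq> carrier G" "B \<subseteq> carrier G" "card A * card B \<le> p^2 * q"
    and "\<And>x y. \<exists>a\<in>A. \<exists>b\<in>B. reduce (p^2) q (a + b) = el x y"
  shows "tiling A B"
proof -
  have "finite A" "finite B"
    using assms(1,2) finite_subset[OF _ finite_carrier_G] by blast+
  then have "reduce.factorization (p^2) q A (\<lambda>a. a) B (\<lambda>b. b)"
  proof (rule reduce.factorizationI_card)
    show "card A * card B \<le> card (range (reduce (p^2) q))"
      using assms(3) by (simp add: range_reduce card_G)
    show "\<exists>a\<in>A. \<exists>b\<in>B. reduce (p^2) q (a + b) = reduce (p^2) q z" for z
      using assms(4)[of "fst z" "snd z"] by (simp add: reduce_def)
  qed
  with assms show ?thesis by (simp add: tiling_def)
qed

lemma coprime_p2_q: "coprime (int (p^2)) (int q)"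
  using p q pq by (simp add: primes_coprime)

text \<open>By the Chinese remainder theorem there is a natural number \<open>k\<close> congruent to \<open>c\<close> modulo \<open>p\<^sup>2\<close> and to \<open>d\<close>
  modulo \<open>q\<close>.  The conditions on \<open>c\<close> and \<open>d\<close> make it coprime to \<open>|A|\<close>, so \<open>k A + B\<close> is again a
  factorization, and the congruences say that two of its sums coincide.\<close>

lemma multiplier:
  assumes t: "tiling A B"
    and cd: "p dvd card A \<longrightarrow> \<not> int p dvd c" "q dvd card A \<longrightarrow> \<not> int q dvd d"
    and A: "(x, y) \<in> A" "(x', y') \<in> A" and B: "(u, v) \<in> B" "(u', v') \<in> B"
    and eq: "[c * (x - x') = u - u'] (mod int p ^ 2)" "[d * (y - y') = v - v'] (mod int q)"
  shows "x = x' \<and> y = y' \<and> u = u' \<and> v = v'"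
proof -
  have fin: "finite A" "finite B" using finite_tiles[OF t] by auto
  have "coprime (int (p\<^sup>2)) (int q)" by (rule coprime_p2_q)
  from binary_chinese_remainder_int[OF this]
  obtain z where z: "[z = c] (mod int (p^2))" "[z = d] (mod int q)" by blast
  define k where "k = nat (z mod int (p^2 * q))"
  have "int k = z mod int (p^2 * q)"
    unfolding k_def by (simp add: pos_mod_sign)
  then have k0: "[int k = z] (mod int (p^2 * q))" by (simp add: cong_def)
  have "[int k = z] (mod int (p^2))" "[int k = z] (mod int q)"
    by (rule cong_dvd_modulus[OF k0]; simp)+
  then have k: "[int k = c] (mod int (p^2))" "[int k = d] (mod int q)"
    using z by (blast intro: cong_trans)+
  have cop: "coprime k (card A)"
  proof (rule ccontr)
    assume "\<not> coprime k (card A)"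
    then obtain r where r: "prime r" "r dvd k" "r dvd card A"
      by (metis coprime_iff_gcd_eq_1 gcd_greatest_iff prime_factor_nat)
    then have "r dvd p^2 * q" using card_tiles[OF t] by (metis dvd_mult2)
    then have "r = p \<or> r = q"
      using r(1) p q by (meson prime_dvd_mult_iff prime_dvd_power primes_dvd_imp_eq)
    moreover have "[int k = c] (mod int p)"
      using k(1) by (meson cong_dvd_modulus dvd_power of_nat_dvd_iff zero_less_numeral)
    ultimately show False
      using r k(2) cd by (metis cong_dvd_iff of_nat_dvd_iff)
  qed
  have "(x, y) = (x', y') \<and> (u', v') = (u, v)"
  \<comment> \<open>Being coprime to \<open>0\<close> leaves only a singleton \<open>A\<close>.\<close>
  proof (cases "k = 0")
    case True
    then have "card A = 1" using cop by simp
    then have "x = x' \<and> y = y'" using A by (auto simp: card_1_singleton_iff)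
    moreover from this have "int (p^2) dvd u - u'" "int q dvd v - v'"
      using eq by (simp_all add: cong_iff_dvd_diff dvd_diff_commute)
    ultimately show ?thesis
      using B t carrier_dvd_diff_iff[of u v u' v'] by (auto simp: tiling_def subset_iff)
  next
    case False
    then have "reduce.factorization (p^2) q A (\<lambda>a. nat_mult k a) B (\<lambda>b. b)"
      using t fin cop by (intro reduce.factorization_nat_mult) (auto simp: tiling_def)
    then have inj: "inj_on (\<lambda>(a, b). reduce (p^2) q (nat_mult k a + b)) (A \<times> B)"
      by (simp add: reduce.factorization_def bij_betw_def)
    have "[int k * (x - x') = u - u'] (mod int (p^2))" "[int k * (y - y') = v - v'] (mod int q)"
      using eq k by (auto intro: cong_trans cong_scalar_right)
    then have "reduce (p^2) q (nat_mult k (x, y) + (u', v')) = reduce (p^2) q (nat_mult k (x', y') + (u, v))"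
      by (simp add: nat_mult_Pair reduce_def residue_pair_eq_iff cong_iff_dvd_diff algebra_simps)
    then show ?thesis using inj_onD[OF inj, of "((x, y), (u', v'))" "((x', y'), (u, v))"] A B by auto
  qed
  then show ?thesis by auto
qed

text \<open>For a set of reduced pairs this says that some difference generates the whole cyclic group.\<close>

definition generic :: "(int \<times> int) set \<Rightarrow> bool" where
  "generic A \<longleftrightarrow> (\<exists>x y x' y'. (x, y) \<in> A \<and> (x', y') \<in> A \<and> \<not> int p dvd x - x' \<and> y \<noteq> y')"

text \<open>A single element with both properties need not be present: if the two given elements each fail the
  other condition, their difference does not.\<close>

lemma genericI:
  assumes "(0, 0) \<in> A" "(x, y) \<in> A" "\<not> int p dvd x" "(x', y') \<in> A" "y' \<noteq> 0"
  shows "generic A"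
proof (cases "y = 0")
  case False
  then show ?thesis using assms unfolding generic_def by (metis diff_zero)
next
  case y: True
  show ?thesis
  proof (cases "int p dvd x'")
    case True
    then have "\<not> int p dvd x' - x" using assms(3) by (metis dvd_diff_right_iff)
    then show ?thesis using assms y unfolding generic_def by blast
  next
    case False
    then show ?thesis using assms unfolding generic_def by (metis diff_zero)
  qed
qed

text \<open>The pairs with first coordinate divisible by \<open>p\<close> and those with second coordinate zero form proper
  subgroups, so a generating set has an element outside of each.\<close>

lemma generating_set_generic:
  assumes S: "S \<subseteq> carrier G" and gen: "generate G S = carrier G"
  shows "generic (S \<union> {(0, 0)})"
proof -
  interpret G: group G by (rule group_ZxZ)
  have proper: "\<exists>s\<in>S. \<not> P s"
    if sub: "subgroup {z \<in> carrier G. P z} G" and g: "g \<in> carrier G" "\<not> P g" for P g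
    using G.generate_subgroup_incl[OF _ sub, of S] S gen g by blast
  have p2: "int p < int (p^2)" using prime_gt_1_nat[OF p] by (simp add: power2_eq_square)
  have g: "(1, 0) \<in> carrier G" "(0, 1) \<in> carrier G"
    using prime_gt_1_nat[OF p] prime_gt_1_nat[OF q] p2 by (auto simp: carrier_G)
  have mod: "int p dvd x mod (int p)^2 \<longleftrightarrow> int p dvd x" for x
    by (simp add: dvd_mod_iff)
  have "subgroup {z \<in> carrier G. int p dvd fst z} G"
    using G.one_closed by (intro G.subgroupI)
      (auto simp: one_ZxZ mult_ZxZ inv_ZxZ reduce_in_carrier, auto simp: reduce_def residue_pair_def mod)
  from proper[OF this g(1)] obtain x y where x: "(x, y) \<in> S" "\<not> int p dvd x"
    using prime_gt_1_nat[OF p] by auto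
  have "subgroup {z \<in> carrier G. snd z = 0} G"
    using G.one_closed by (intro G.subgroupI)
      (auto simp: one_ZxZ mult_ZxZ inv_ZxZ reduce_in_carrier, auto simp: reduce_def residue_pair_def)
  from proper[OF this g(2)] obtain x' y' where "(x', y') \<in> S" "y' \<noteq> 0" by auto
  with x show ?thesis by (intro genericI) auto
qed

lemma q_not_dvd_p_power: "\<not> q dvd p ^ k" and p_not_dvd_q: "\<not> p dvd q"
  using p q pq by (auto dest: prime_dvd_power primes_dvd_imp_eq)

text \<open>A generic difference of \<open>A\<close> can be multiplied into any pair whose first coordinate is prime to \<open>p\<close>,
  since the multiplier of the second coordinate may even vanish modulo \<open>q\<close>.\<close>

lemma generic_imp_fst_cong:
  assumes t: "tiling A B" and gen: "generic A" and qA: "\<not> q dvd card A"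
    and B: "(u, v) \<in> B" "(u', v') \<in> B"
  shows "int p dvd u - u'"
proof (rule ccontr)
  assume u: "\<not> int p dvd u - u'"
  obtain x y x' y' where A: "(x, y) \<in> A" "(x', y') \<in> A" and x: "\<not> int p dvd x - x'" and y: "y \<noteq> y'"
    using gen by (auto simp: generic_def)
  have "\<not> int q dvd y - y'"
    using y A t carrier_dvd_diff_iff[of x y x' y'] by (auto simp: tiling_def subset_iff)
  then obtain d where d: "[d * (y - y') = v - v'] (mod int q ^ 1)"
    using prime_multiplier_ex[OF q] zero_less_one by blast
  obtain c where c: "[c * (x - x') = u - u'] (mod int p ^ 2)" "\<not> int p dvd c"
    using prime_multiplier_ex[OF p x, of 2] u by auto
  have "x = x' \<and> y = y' \<and> u = u' \<and> v = v'"
    by (rule multiplier[OF t _ _ A B c(1)]) (use c qA d in auto)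
  then show False using y by blast
qed

text \<open>Here the multiplier of the first coordinate is unrestricted, so a generic difference of \<open>A\<close> can be
  multiplied into any pair whose second coordinate is nonzero.\<close>

lemma generic_imp_snd_const:
  assumes t: "tiling A B" and gen: "generic A" and pA: "\<not> p dvd card A"
    and B: "(u, v) \<in> B" "(u', v') \<in> B"
  shows "v = v'"
proof (rule ccontr)
  assume v: "v \<noteq> v'"
  obtain x y x' y' where A: "(x, y) \<in> A" "(x', y') \<in> A" and x: "\<not> int p dvd x - x'" and y: "y \<noteq> y'"
    using gen by (auto simp: generic_def)
  have "\<not> int q dvd y - y'" "\<not> int q dvd v - v'"
    using y v A B t carrier_dvd_diff_iff[of x y x' y'] carrier_dvd_diff_iff[of u v u' v']
    by (auto simp: tiling_def subset_iff)
  then obtain d where d: "[d * (y - y') = v - v'] (mod int q ^ 1)" "\<not> int q dvd d"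
    using prime_multiplier_ex[OF q] zero_less_one by blast
  obtain c where c: "[c * (x - x') = u - u'] (mod int p ^ 2)"
    using prime_multiplier_ex[OF p x, of 2] by auto
  have "x = x' \<and> y = y' \<and> u = u' \<and> v = v'"
    by (rule multiplier[OF t _ _ A B c(1)]) (use pA d in auto)
  then show False using y by blast
qed

text \<open>Differences whose first coordinate is a nonzero multiple of \<open>p\<close> are multiples of each other by units in the first
  coordinate; in the second coordinate only a zero cannot be moved to a nonzero value.\<close>

lemma P_difference_conflict:
  assumes t: "tiling A B" and qA: "\<not> q dvd card A"
    and A: "(x, y) \<in> A" "(x', y') \<in> A" and B: "(u, v) \<in> B" "(u', v') \<in> B"
    and x: "int p dvd x - x'" "x \<noteq> x'" and u: "int p dvd u - u'" "u \<noteq> u'"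
    and y: "y = y' \<longrightarrow> v = v'"
  shows False
proof -
  have G: "(x, y) \<in> carrier G" "(x', y') \<in> carrier G" "(u, v) \<in> carrier G" "(u', v') \<in> carrier G"
    using A B t by (auto simp: tiling_def)
  have "\<exists>d. [d * (y - y') = v - v'] (mod int q)"
  proof (cases "y = y'")
    case False
    then show ?thesis
      using prime_multiplier_ex[OF q, of "y - y'" 1 "v - v'"] carrier_dvd_diff_iff[OF G(1,2)] by auto
  qed (use y in auto)
  then obtain d where d: "[d * (y - y') = v - v'] (mod int q)" by blast
  obtain c where c: "[c * (x - x') = u - u'] (mod int p ^ 2)" "\<not> int p dvd c"
    using prime_multiplier_square_ex[OF p x(1) u(1)] x(2) u(2)
      carrier_dvd_diff_iff[OF G(1,2)] carrier_dvd_diff_iff[OF G(3,4)] by auto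
  have "x = x' \<and> y = y' \<and> u = u' \<and> v = v'"
    by (rule multiplier[OF t _ _ A B c(1) d]) (use qA c in auto)
  then show False using x by blast
qed

text \<open>The multipliers \<open>c = 1\<close> and \<open>d = 0\<close> project \<open>A\<close> injectively to the first coordinate.\<close>

lemma fst_determines_snd:
  assumes t: "tiling A B" and qA: "\<not> q dvd card A" and A: "(x, y) \<in> A" "(x, y') \<in> A"
    and B: "(0, 0) \<in> B"
  shows "y = y'"
  using multiplier[OF t, of 1 0 x y x y' 0 0 0 0] A B qA prime_gt_1_nat[OF p] by auto

lemma snd_determines_fst:
  assumes t: "tiling A B" and pA: "\<not> p dvd card A" and A: "(x, y) \<in> A" "(x', y) \<in> A"
    and B: "(0, 0) \<in> B"
  shows "x = x'"
  using multiplier[OF t, of 0 1 x y x' y 0 0 0 0] A B pA prime_gt_1_nat[OF q] by auto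

lemma no_common_difference:
  assumes t: "tiling A B" and A: "(x, y) \<in> A" "(x', y') \<in> A" and B: "(u, v) \<in> B" "(u', v') \<in> B"
    and "[x - x' = u - u'] (mod int p ^ 2)" "[y - y' = v - v'] (mod int q)"
  shows "x = x' \<and> y = y'"
  using multiplier[OF t _ _ A B, of 1 1] assms prime_gt_1_nat[OF p] prime_gt_1_nat[OF q] by auto

text \<open>The multiplier \<open>d = 0\<close> removes the second coordinate of the difference of \<open>A\<close>.\<close>

lemma unit_difference_imp_fst_cong:
  assumes t: "tiling A B" and qA: "\<not> q dvd card A" and A: "(x, y) \<in> A" "(x', y') \<in> A"
    and B: "(u, v) \<in> B" "(u', v) \<in> B" and x: "\<not> int p dvd x - x'"
  shows "int p dvd u - u'"
proof (rule ccontr)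
  assume u: "\<not> int p dvd u - u'"
  obtain c where c: "[c * (x - x') = u - u'] (mod int p ^ 2)" "\<not> int p dvd c"
    using prime_multiplier_ex[OF p x, of 2] u by auto
  have "x = x' \<and> y = y' \<and> u = u' \<and> v = v"
    by (rule multiplier[OF t _ _ A B c(1), of 0]) (use c qA in auto)
  then show False using x by simp
qed

lemma p_dvd_iff_nat_mod: "int p dvd x - x' \<longleftrightarrow> nat (x mod int p) = nat (x' mod int p)"
  using pos(1) by (simp add: eq_nat_nat_iff mod_eq_dvd_iff)

lemma carrier_nat_inj:
  assumes "(x, y) \<in> carrier G" "(x', y') \<in> carrier G"
  shows "nat x = nat x' \<Longrightarrow> x = x'" and "nat y = nat y' \<Longrightarrow> y = y'"
  using assms by (auto simp: carrier_G)

lemma carrier_coordinates: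
  assumes "(x, y) \<in> carrier G"
  shows "nat (x mod int p) < p" "nat (x div int p) < p" "nat x < p^2" "nat y < q"
    and "int (nat (x mod int p)) = x mod int p" "int (nat (x div int p)) = x div int p"
    and "int (nat x) = x" "int (nat y) = y"
    and "el x y = (x, y)" "x mod int p + (x div int p) * int p = x"
proof -
  have x: "0 \<le> x" "x < int p * int p" "0 \<le> y" "y < int q"
    using assms unfolding carrier_G by (auto simp: power2_eq_square)
  then show "int (nat (x mod int p)) = x mod int p"
    and div: "int (nat (x div int p)) = x div int p"
    by (simp_all add: pos_imp_zdiv_nonneg_iff)
  have "x div int p * int p \<le> x"
    using x(1) pos(1) by (metis minus_mod_eq_div_mult diff_le_self pos_mod_sign of_nat_0_less_iff le_add_same_cancel1 diff_add_cancel)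
  then have "x div int p * int p < int p * int p" using x by linarith
  then have "x div int p < int p" using pos(1) by (simp add: mult_less_cancel_right)
  then show "nat (x div int p) < p" using div by linarith
  show "nat (x mod int p) < p" by (simp add: nat_less_iff)
  show "el x y = (x, y)" using x by (simp add: residue_pair_def power2_eq_square)
  show "nat x < p^2" "nat y < q" "int (nat x) = x" "int (nat y) = y"
    using x by (auto simp: power2_eq_square nat_less_iff)
  show "x mod int p + (x div int p) * int p = x" by simp
qed

section \<open>The possible shapes of the two factors\<close>

text \<open>This provides the integer families of the classification: if the parameter \<open>par\<close> of an element depends
  only on its index \<open>key\<close>, it is a function of the index.  The value at the index of \<open>0\<close> is then
  automatically zero.\<close>

lemma key_function:
  assumes "(0, 0) \<in> A" "key 0 0 = k" "par 0 0 = 0"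
    and det: "\<And>x y x' y'. (x, y) \<in> A \<Longrightarrow> (x', y') \<in> A \<Longrightarrow> key x y = key x' y' \<Longrightarrow> par x y = par x' y'"
  shows "\<exists>\<alpha>. \<alpha> k = 0 \<and> (\<forall>x y. (x, y) \<in> A \<longrightarrow> \<alpha> (key x y) = par x y)"
proof -
  define \<alpha> where "\<alpha> i = (case SOME s. s \<in> A \<and> case_prod key s = i of (x, y) \<Rightarrow> par x y)" for i
  have \<alpha>: "\<alpha> (key x y) = par x y" if xy: "(x, y) \<in> A" for x y
  proof -
    obtain x' y' where s: "(SOME s. s \<in> A \<and> case_prod key s = key x y) = (x', y')"
      by fastforce
    have "\<exists>s. s \<in> A \<and> case_prod key s = key x y" using xy by force
    from someI_ex[OF this] have "(x', y') \<in> A" "key x' y' = key x y" by (simp_all add: s)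
    then show ?thesis using det[OF _ xy] by (simp add: \<alpha>_def s)
  qed
  then show ?thesis using assms(1-3) by metis
qed

text \<open>The Chinese remainder isomorphism with a linear inverse, so that zero goes to zero.\<close>

lemma crt_ex: "\<exists>h :: int \<Rightarrow> int \<Rightarrow> int. h 0 0 = 0 \<and>
    (\<forall>a b. [h a b = a] (mod int p) \<and> [h a b = b] (mod int q))"
proof -
  have c: "coprime (int p) (int q)" using p q pq by (simp add: primes_coprime)
  obtain e where e: "[e = 1] (mod int p)" "[e = 0] (mod int q)"
    using binary_chinese_remainder_int[OF c] by blast
  obtain f where f: "[f = 0] (mod int p)" "[f = 1] (mod int q)"
    using binary_chinese_remainder_int[OF c] by blast
  have "[a * e + b * f = a * 1 + b * 0] (mod int p)" "[a * e + b * f = a * 0 + b * 1] (mod int q)" for a b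
    using e f by (intro cong_add cong_scalar_left; simp)+
  then show ?thesis by (intro exI[of _ "\<lambda>a b. a * e + b * f"]) simp
qed

lemma residue_pair_p_shift:
  assumes "(x, y) \<in> carrier G" "[a = x div int p] (mod int p)" "[b = y] (mod int q)"
  shows "el (int (nat (x mod int p)) + a * int p) b = (x, y)"
proof -
  have "[a * int p = x div int p * int p] (mod int p * int p)"
    using assms(2) by (simp add: cong_iff_dvd_diff flip: left_diff_distrib)
  then have "[x mod int p + a * int p = x mod int p + x div int p * int p] (mod int p * int p)"
    by (rule cong_add[OF cong_refl])
  then have "el (int (nat (x mod int p)) + a * int p) b = el x y"
    unfolding residue_pair_eq_iff carrier_coordinates(5)[OF assms(1)] using assms(3)
    by (simp add: power2_eq_square)
  then show ?thesis using carrier_coordinates[OF assms(1)] by simp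
qed

lemma p_multiple_coordinates:
  assumes "(x, y) \<in> carrier G" "int p dvd x"
  shows "int (nat (x div int p)) * int p = x"
  using assms carrier_coordinates[OF assms(1)] by simp

text \<open>Genericity forces \<open>B\<close> to be the subgroup \<open>P \<times> \<int>\<^sub>q\<close>, and a complement of a subgroup is a
  transversal of its cosets.  A single family \<open>\<alpha>\<close> serves both coordinates because \<open>\<alpha>\<^sub>i\<close> matters modulo
  \<open>p\<close> in the first and modulo \<open>q\<close> in the second one.\<close>

lemma tiling_card_p:
  assumes t: "tiling A B" and gen: "generic A" and 0: "(0, 0) \<in> A" "(0, 0) \<in> B" and card: "card A = p"
  shows "\<exists>\<alpha> :: nat \<Rightarrow> int. \<alpha> 0 = 0 \<and>
        A = {el (int i + \<alpha> i * int p) (\<alpha> i) | i. i < p} \<and>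
        B = {el (int i * int p) (int j) | i j. i < p \<and> j < q}"
proof -
  have sub: "A \<subseteq> carrier G" "B \<subseteq> carrier G" using t by (auto simp: tiling_def)
  have qA: "\<not> q dvd card A" using q_not_dvd_p_power[of 1] card by simp
  have cB: "card B = p * q" using card_tiles[OF t] card pos(1,2) by (simp add: power2_eq_square)
  have B: "B = {el (int i * int p) (int j) | i j. i < p \<and> j < q}"
  proof (rule eq_family2I)
    show "B \<subseteq> {el (int i * int p) (int j) | i j. i < p \<and> j < q}"
    proof clarify
      fix u v assume uv: "(u, v) \<in> B"
      then have "int p dvd u" using generic_imp_fst_cong[OF t gen qA uv 0(2)] by simp
      then show "\<exists>i j. (u, v) = el (int i * int p) (int j) \<and> i < p \<and> j < q"
        using uv sub carrier_coordinates[of u v] p_multiple_coordinates[of u v]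
        by (intro exI[of _ "nat (u div int p)"] exI[of _ "nat v"]) auto
    qed
  qed (simp add: cB)
  have BI: "(u, v) \<in> B" if "(u, v) \<in> carrier G" "int p dvd u" for u v
  proof -
    have "(u, v) = el (int (nat (u div int p)) * int p) (int (nat v))"
      using p_multiple_coordinates[OF that] carrier_coordinates(8,9)[OF that(1)] by simp
    then show ?thesis unfolding B using carrier_coordinates(2,4)[OF that(1)] by blast
  qed
  have inj: "x = x' \<and> y = y'" if "(x, y) \<in> A" "(x', y') \<in> A" "int p dvd x - x'" for x y x' y'
  proof -
    have "el (x - x') (y - y') \<in> carrier G"
      using reduce_in_carrier[of "p^2" q "(x - x', y - y')"] by (simp add: reduce_Pair)
    moreover have "int p dvd (x - x') mod int (p^2)" using that(3) by (simp add: dvd_mod)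
    ultimately have "el (x - x') (y - y') \<in> B" using BI by (simp add: residue_pair_def)
    then show ?thesis
      using no_common_difference[OF t that(1,2) _ 0(2)] by (simp add: residue_pair_def)
  qed
  obtain h :: "int \<Rightarrow> int \<Rightarrow> int" where h: "h 0 0 = 0"
    "\<And>a b. [h a b = a] (mod int p)" "\<And>a b. [h a b = b] (mod int q)" using crt_ex by blast
  obtain \<alpha> where \<alpha>: "\<alpha> 0 = 0" "\<And>x y. (x, y) \<in> A \<Longrightarrow> \<alpha> (nat (x mod int p)) = h (x div int p) y"
  proof -
    have "h (x div int p) y = h (x' div int p) y'"
      if "(x, y) \<in> A" "(x', y') \<in> A" "nat (x mod int p) = nat (x' mod int p)" for x y x' y'
      using inj that unfolding p_dvd_iff_nat_mod by blast
    then have "\<exists>\<alpha>. \<alpha> 0 = 0 \<and> (\<forall>x y. (x, y) \<in> A \<longrightarrow> \<alpha> (nat (x mod int p)) = h (x div int p) y)"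
      by (intro key_function[where key = "\<lambda>x y. nat (x mod int p)", OF 0(1)])
        (simp, simp add: h(1), blast)
    then show thesis using that by blast
  qed
  have "A = {el (int i + \<alpha> i * int p) (\<alpha> i) | i. i < p}"
  proof (rule eq_familyI)
    show "A \<subseteq> {el (int i + \<alpha> i * int p) (\<alpha> i) | i. i < p}"
    proof clarify
      fix x y assume xy: "(x, y) \<in> A"
      then show "\<exists>i. (x, y) = el (int i + \<alpha> i * int p) (\<alpha> i) \<and> i < p"
        using sub \<alpha>(2)[OF xy] residue_pair_p_shift[of x y "h (x div int p) y" "h (x div int p) y"] h
          carrier_coordinates(1)[of x y]
        by (intro exI[of _ "nat (x mod int p)"]) (auto simp: subset_iff)
    qed
  qed (simp add: card)
  with \<alpha> B show ?thesis by blast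
qed

text \<open>Genericity makes the second coordinate constant on \<open>B\<close>, so \<open>B\<close> is the subgroup of order \<open>p\<^sup>2\<close> and \<open>A\<close>
  is a transversal of it.\<close>

lemma tiling_card_q:
  assumes t: "tiling A B" and gen: "generic A" and 0: "(0, 0) \<in> A" "(0, 0) \<in> B" and card: "card A = q"
  shows "\<exists>\<alpha> :: nat \<Rightarrow> int. \<alpha> 0 = 0 \<and>
        A = {el (\<alpha> i) (int i) | i. i < q} \<and>
        B = {el (int i) 0 | i. i < p^2}"
proof -
  have sub: "A \<subseteq> carrier G" "B \<subseteq> carrier G" using t by (auto simp: tiling_def)
  have pA: "\<not> p dvd card A" using p_not_dvd_q card by simp
  have cB: "card B = p^2" using card_tiles[OF t] card pos(1,2) by simp
  have B: "B = {el (int i) 0 | i. i < p^2}"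
  proof (rule eq_familyI)
    show "B \<subseteq> {el (int i) 0 | i. i < p^2}"
    proof clarify
      fix u v assume uv: "(u, v) \<in> B"
      then have "v = 0" using generic_imp_snd_const[OF t gen pA uv 0(2)] by simp
      then show "\<exists>i. (u, v) = el (int i) 0 \<and> i < p^2"
        using uv sub carrier_coordinates[of u v] by (intro exI[of _ "nat u"]) auto
    qed
  qed (simp add: cB)
  obtain \<alpha> where \<alpha>: "\<alpha> 0 = 0" "\<And>x y. (x, y) \<in> A \<Longrightarrow> \<alpha> (nat y) = x"
  proof -
    have "x = x'" if xy: "(x, y) \<in> A" "(x', y') \<in> A" "nat y = nat y'" for x y x' y'
    proof -
      have "y = y'" using carrier_nat_inj(2)[of x y x' y'] xy sub by blast
      then show ?thesis using snd_determines_fst[OF t pA _ _ 0(2)] xy by blast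
    qed
    then have "\<exists>\<alpha>. \<alpha> 0 = 0 \<and> (\<forall>x y. (x, y) \<in> A \<longrightarrow> \<alpha> (nat y) = x)"
      by (intro key_function[where key = "\<lambda>x y. nat y", OF 0(1)])
        (simp, simp, blast)
    then show thesis using that by blast
  qed
  have "A = {el (\<alpha> i) (int i) | i. i < q}"
  proof (rule eq_familyI)
    show "A \<subseteq> {el (\<alpha> i) (int i) | i. i < q}"
    proof clarify
      fix x y assume xy: "(x, y) \<in> A"
      then show "\<exists>i. (x, y) = el (\<alpha> i) (int i) \<and> i < q"
        using sub \<alpha>(2)[OF xy] carrier_coordinates[of x y] by (intro exI[of _ "nat y"]) auto
    qed
  qed (simp add: card)
  with \<alpha> B show ?thesis by blast
qed

text \<open>The orders of \<open>A\<close> and \<open>B\<close> are coprime, so both are graphs: \<open>A\<close> over the first coordinate and \<open>B\<close> over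
  the second.  Genericity puts the first coordinates of \<open>B\<close> into \<open>P\<close>.  If one of them is not zero, two
  elements of \<open>A\<close> congruent modulo \<open>p\<close> in the first coordinate must agree in the second, since
  otherwise their difference could be multiplied into a difference of \<open>B\<close>.\<close>

lemma tiling_card_p2:
  assumes t: "tiling A B" and gen: "generic A" and 0: "(0, 0) \<in> A" "(0, 0) \<in> B" and card: "card A = p^2"
  shows "(\<exists>\<alpha> lam :: nat \<Rightarrow> int. \<alpha> 0 = 0 \<and> lam 0 = 0 \<and>
        A = {el (int i + int j * int p) (\<alpha> i) | i j. i < p \<and> j < p} \<and>
        B = {el (lam i * int p) (int i) | i. i < q})
    \<or> (\<exists>\<alpha> :: nat \<Rightarrow> int. \<alpha> 0 = 0 \<and>
        A = {el (int i) (\<alpha> i) | i. i < p^2} \<and>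
        B = {el 0 (int i) | i. i < q})"
proof -
  have sub: "A \<subseteq> carrier G" "B \<subseteq> carrier G" using t by (auto simp: tiling_def)
  have qA: "\<not> q dvd card A" using q_not_dvd_p_power card by simp
  have cB: "card B = q" using card_tiles[OF t] card pos(1,2) by simp
  then have pB: "\<not> p dvd card B" using p_not_dvd_q by simp
  have u: "int p dvd u" if "(u, v) \<in> B" for u v
    using generic_imp_fst_cong[OF t gen qA that 0(2)] by simp
  have Binj: "u = u'" if "(u, v) \<in> B" "(u', v) \<in> B" for u v u'
    using snd_determines_fst[OF tiling_sym[OF t] pB that 0(1)] .
  show ?thesis
  proof (cases "\<forall>u v. (u, v) \<in> B \<longrightarrow> u = 0")
    case True
    have B: "B = {el 0 (int i) | i. i < q}"
    proof (rule eq_familyI)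
      show "B \<subseteq> {el 0 (int i) | i. i < q}"
      proof clarify
        fix u v assume uv: "(u, v) \<in> B"
        then have u0: "u = 0" and "(0, v) \<in> carrier G" using True sub by blast+
        then show "\<exists>i. (u, v) = el 0 (int i) \<and> i < q"
          using carrier_coordinates(4,8,9)[of 0 v] by (intro exI[of _ "nat v"]) simp
      qed
    qed (simp add: cB)
    obtain \<alpha> where \<alpha>: "\<alpha> 0 = 0" "\<And>x y. (x, y) \<in> A \<Longrightarrow> \<alpha> (nat x) = y"
    proof -
      have "y = y'" if xy: "(x, y) \<in> A" "(x', y') \<in> A" "nat x = nat x'" for x y x' y'
      proof -
        have "x = x'" using carrier_nat_inj(1)[of x y x' y'] xy sub by blast
        then show ?thesis using fst_determines_snd[OF t qA _ _ 0(2)] xy by blast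
      qed
      then have "\<exists>\<alpha>. \<alpha> 0 = 0 \<and> (\<forall>x y. (x, y) \<in> A \<longrightarrow> \<alpha> (nat x) = y)"
        by (intro key_function[where key = "\<lambda>x y. nat x", OF 0(1)])
          (simp, simp, blast)
      then show thesis using that by blast
    qed
    have "A = {el (int i) (\<alpha> i) | i. i < p^2}"
    proof (rule eq_familyI)
      show "A \<subseteq> {el (int i) (\<alpha> i) | i. i < p^2}"
      proof clarify
        fix x y assume xy: "(x, y) \<in> A"
        then show "\<exists>i. (x, y) = el (int i) (\<alpha> i) \<and> i < p^2"
          using sub \<alpha>(2)[OF xy] carrier_coordinates[of x y] by (intro exI[of _ "nat x"]) auto
      qed
    qed (simp add: card)
    with \<alpha> B show ?thesis by blast
  next
    case False
    then obtain u1 v1 where uv1: "(u1, v1) \<in> B" "u1 \<noteq> 0" by blast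
    have Ainj: "y = y'" if "(x, y) \<in> A" "(x', y') \<in> A" "int p dvd x - x'" for x y x' y'
    proof (rule ccontr)
      assume y: "y \<noteq> y'"
      then have "x \<noteq> x'" using fst_determines_snd[OF t qA _ _ 0(2), of x y y'] that by blast
      then show False
        using P_difference_conflict[OF t qA that(1,2) uv1(1) 0(2) that(3)] y u[OF uv1(1)] uv1(2) by simp
    qed
    have "\<exists>\<alpha>. \<alpha> 0 = 0 \<and> (\<forall>x y. (x, y) \<in> A \<longrightarrow> \<alpha> (nat (x mod int p)) = y)"
      by (intro key_function[where key = "\<lambda>x y. nat (x mod int p)", OF 0(1)])
        (simp, simp, blast intro: Ainj[unfolded p_dvd_iff_nat_mod])
    then obtain \<alpha> where \<alpha>: "\<alpha> 0 = 0" "\<And>x y. (x, y) \<in> A \<Longrightarrow> \<alpha> (nat (x mod int p)) = y"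
      by blast
    have A: "A = {el (int i + int j * int p) (\<alpha> i) | i j. i < p \<and> j < p}"
    proof (rule eq_family2I)
      show "A \<subseteq> {el (int i + int j * int p) (\<alpha> i) | i j. i < p \<and> j < p}"
      proof clarify
        fix x y assume xy: "(x, y) \<in> A"
        then show "\<exists>i j. (x, y) = el (int i + int j * int p) (\<alpha> i) \<and> i < p \<and> j < p"
          using sub \<alpha>(2)[OF xy] carrier_coordinates[of x y]
          by (intro exI[of _ "nat (x mod int p)"] exI[of _ "nat (x div int p)"]) auto
      qed
    qed (simp add: card power2_eq_square)
    obtain lam where lam: "lam 0 = 0" "\<And>u v. (u, v) \<in> B \<Longrightarrow> lam (nat v) = u div int p"
    proof -
      have "u div int p = u' div int p" if uv: "(u, v) \<in> B" "(u', v') \<in> B" "nat v = nat v'" for u v u' v'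
      proof -
        have "v = v'" using carrier_nat_inj(2)[of u v u' v'] uv sub by blast
        then show ?thesis using Binj uv by blast
      qed
      then have "\<exists>\<alpha>. \<alpha> 0 = 0 \<and> (\<forall>u v. (u, v) \<in> B \<longrightarrow> \<alpha> (nat v) = u div int p)"
        by (intro key_function[where key = "\<lambda>u v. nat v", OF 0(2)])
          (simp, simp, blast)
      then show thesis using that by blast
    qed
    have "B = {el (lam i * int p) (int i) | i. i < q}"
    proof (rule eq_familyI)
      show "B \<subseteq> {el (lam i * int p) (int i) | i. i < q}"
      proof clarify
        fix x y assume xy: "(x, y) \<in> B"
        then show "\<exists>i. (x, y) = el (lam i * int p) (int i) \<and> i < q"
          using sub lam(2)[OF xy] u[OF xy] carrier_coordinates[of x y] by (intro exI[of _ "nat y"]) auto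
      qed
    qed (simp add: cB)
    with \<alpha> lam A show ?thesis by blast
  qed
qed

text \<open>Now \<open>|A|\<close> is divisible by both primes and only \<open>B\<close>, of order \<open>p\<close>, has multipliers.  It is a graph over
  the first coordinate.

  If \<open>B\<close> has a first coordinate prime to \<open>p\<close>, then \<open>B\<close> has zero second coordinates, as otherwise it would be
  generic and force the first coordinates of \<open>A\<close> to agree modulo \<open>p\<close>; moreover, \<open>A\<close> meets each row, that is, each set of pairs
  with a fixed second coordinate, in a coset of \<open>P\<close>.

  If all first coordinates of \<open>B\<close> lie in \<open>P\<close>, then either \<open>B = P \<times> {0}\<close>, or \<open>B\<close> has an element with both
  coordinates nonzero.  In the latter case its multiples exclude all differences of \<open>A\<close> with first
  coordinate in \<open>P \<setminus> {0}\<close>, so that all rows of \<open>A\<close> coincide.\<close>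

lemma tiling_card_pq:
  assumes t: "tiling A B" and gen: "generic A" and 0: "(0, 0) \<in> A" "(0, 0) \<in> B" and card: "card A = p * q"
  shows "(\<exists>\<alpha> lam :: nat \<Rightarrow> int. \<alpha> 0 = 0 \<and> lam 0 = 0 \<and>
        A = {el (int i + \<alpha> i * int p) (int j) | i j. i < p \<and> j < q} \<and>
        B = {el (int i * int p) (lam i) | i. i < p})
    \<or> (\<exists>\<alpha> lam :: nat \<Rightarrow> int. \<alpha> 0 = 0 \<and> lam 0 = 0 \<and>
        A = {el (\<alpha> i + int j * int p) (int i) | i j. i < q \<and> j < p} \<and>
        B = {el (int i + lam i * int p) 0 | i. i < p})
    \<or> (\<exists>\<alpha> :: nat \<Rightarrow> nat \<Rightarrow> int. \<alpha> 0 0 = 0 \<and>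
        A = {el (int i + \<alpha> i j * int p) (int j) | i j. i < p \<and> j < q} \<and>
        B = {el (int i * int p) 0 | i. i < p})"
proof -
  have sub: "A \<subseteq> carrier G" "B \<subseteq> carrier G" using t by (auto simp: tiling_def)
  have cB: "card B = p" using card_tiles[OF t] card pos(1,2) by (simp add: power2_eq_square)
  then have qB: "\<not> q dvd card B" using q_not_dvd_p_power[of 1] by simp
  note t' = tiling_sym[OF t]
  have Binj: "v = v'" if "(u, v) \<in> B" "(u, v') \<in> B" for u v v'
    using fst_determines_snd[OF t' qB that 0(1)] .
  show ?thesis
  proof (cases "\<forall>u v. (u, v) \<in> B \<longrightarrow> int p dvd u")
    case False
    then obtain u0 v0 where u0: "(u0, v0) \<in> B" "\<not> int p dvd u0" by blast
    have v: "v = 0" if "(u, v) \<in> B" for u v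
    proof (rule ccontr)
      assume "v \<noteq> 0"
      then have "generic B" using genericI[OF 0(2) u0 that] by blast
      then have "int p dvd x - x'" if "(x, y) \<in> A" "(x', y') \<in> A" for x y x' y'
        using generic_imp_fst_cong[OF t' _ qB that] by blast
      then show False using gen by (auto simp: generic_def)
    qed
    have ban: "int p dvd x - x'" if "(x, y) \<in> A" "(x', y) \<in> A" for x y x'
      using unit_difference_imp_fst_cong[OF t' qB u0(1) 0(2) that] u0(2) by simp
    obtain \<alpha> where \<alpha>: "\<alpha> 0 = 0" "\<And>x y. (x, y) \<in> A \<Longrightarrow> \<alpha> (nat y) = x mod int p"
    proof -
      have "x mod int p = x' mod int p" if xy: "(x, y) \<in> A" "(x', y') \<in> A" "nat y = nat y'" for x y x' y'
      proof -
        have "y = y'"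
          using carrier_nat_inj(2)[of x y x' y'] xy sub by blast
        then show ?thesis using ban[of x y x'] xy by (simp add: mod_eq_dvd_iff)
      qed
      then have "\<exists>\<alpha>. \<alpha> 0 = 0 \<and> (\<forall>x y. (x, y) \<in> A \<longrightarrow> \<alpha> (nat y) = x mod int p)"
        by (intro key_function[where key = "\<lambda>x y. nat y", OF 0(1)])
          (simp, simp, blast)
      then show thesis using that by blast
    qed
    have A: "A = {el (\<alpha> i + int j * int p) (int i) | i j. i < q \<and> j < p}"
    proof (rule eq_family2I)
      show "A \<subseteq> {el (\<alpha> i + int j * int p) (int i) | i j. i < q \<and> j < p}"
      proof clarify
        fix x y assume xy: "(x, y) \<in> A"
        then show "\<exists>i j. (x, y) = el (\<alpha> i + int j * int p) (int i) \<and> i < q \<and> j < p"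
          using sub \<alpha>(2)[OF xy] carrier_coordinates[of x y]
          by (intro exI[of _ "nat y"] exI[of _ "nat (x div int p)"]) auto
      qed
    qed (simp add: card)
    have AI: "(x, y) \<in> A" if "(x, 0) \<in> carrier G" "int p dvd x" "y = 0" for x y
    proof -
      have "el (\<alpha> 0 + int (nat (x div int p)) * int p) (int 0) \<in> A"
        unfolding A using carrier_coordinates(2)[OF that(1)] pos(2) by blast
      then show ?thesis
        using p_multiple_coordinates[OF that(1,2)] carrier_coordinates(9)[OF that(1)] \<alpha>(1) that(3)
        by simp
    qed
    have Bmod: "u = u'" if "(u, v) \<in> B" "(u', v') \<in> B" "int p dvd u - u'" for u v u' v'
    proof -
      have "el (u - u') 0 \<in> carrier G"
        using reduce_in_carrier[of "p^2" q "(u - u', 0)"] by (simp add: reduce_Pair)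
      moreover have "int p dvd (u - u') mod int (p^2)" using that(3) by (simp add: dvd_mod)
      ultimately have "el (u - u') 0 \<in> A" using AI by (simp add: residue_pair_def)
      then show ?thesis
        using no_common_difference[OF t' that(1,2) _ 0(1)] v[OF that(1)] v[OF that(2)]
        by (simp add: residue_pair_def)
    qed
    have "u div int p = u' div int p"
      if "(u, v) \<in> B" "(u', v') \<in> B" "nat (u mod int p) = nat (u' mod int p)" for u v u' v'
      using Bmod[unfolded p_dvd_iff_nat_mod, OF that] by simp
    then have "\<exists>\<alpha>. \<alpha> 0 = 0 \<and> (\<forall>u v. (u, v) \<in> B \<longrightarrow> \<alpha> (nat (u mod int p)) = u div int p)"
      by (intro key_function[where key = "\<lambda>u v. nat (u mod int p)", OF 0(2)])
        (simp, simp, blast)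
    then obtain lam where lam: "lam 0 = 0" "\<And>u v. (u, v) \<in> B \<Longrightarrow> lam (nat (u mod int p)) = u div int p"
      by blast
    have "B = {el (int i + lam i * int p) 0 | i. i < p}"
    proof (rule eq_familyI)
      show "B \<subseteq> {el (int i + lam i * int p) 0 | i. i < p}"
      proof clarify
        fix x y assume xy: "(x, y) \<in> B"
        then show "\<exists>i. (x, y) = el (int i + lam i * int p) 0 \<and> i < p"
          using sub lam(2)[OF xy] v[OF xy] carrier_coordinates[of x y]
          by (intro exI[of _ "nat (x mod int p)"]) auto
      qed
    qed (simp add: cB)
    with \<alpha> lam A show ?thesis by blast
  next
    case True
    then have u: "int p dvd u" if "(u, v) \<in> B" for u v using that by blast
    have "v = v'" if uv: "(u, v) \<in> B" "(u', v') \<in> B" "nat (u div int p) = nat (u' div int p)" for u v u' v'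
    proof -
      have "u = u'"
        using uv sub u p_multiple_coordinates[of u v] p_multiple_coordinates[of u' v'] by (metis subsetD)
      then show ?thesis using Binj uv by blast
    qed
    then have "\<exists>\<alpha>. \<alpha> 0 = 0 \<and> (\<forall>u v. (u, v) \<in> B \<longrightarrow> \<alpha> (nat (u div int p)) = v)"
      by (intro key_function[where key = "\<lambda>u v. nat (u div int p)", OF 0(2)])
        (simp, simp, blast)
    then obtain lam where lam: "lam 0 = 0" "\<And>u v. (u, v) \<in> B \<Longrightarrow> lam (nat (u div int p)) = v"
      by blast
    have B: "B = {el (int i * int p) (lam i) | i. i < p}"
    proof (rule eq_familyI)
      show "B \<subseteq> {el (int i * int p) (lam i) | i. i < p}"
      proof clarify
        fix x y assume xy: "(x, y) \<in> B"
        then show "\<exists>i. (x, y) = el (int i * int p) (lam i) \<and> i < p"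
          using sub lam(2)[OF xy] u[OF xy] carrier_coordinates[of x y] p_multiple_coordinates[of x y]
          by (intro exI[of _ "nat (x div int p)"]) auto
      qed
    qed (simp add: cB)
    show ?thesis
    proof (cases "\<forall>u v. (u, v) \<in> B \<longrightarrow> v = 0")
      case v: True
      have B: "B = {el (int i * int p) 0 | i. i < p}"
      proof (rule eq_familyI)
        show "B \<subseteq> {el (int i * int p) 0 | i. i < p}"
        proof clarify
          fix x y assume xy: "(x, y) \<in> B"
          then have y: "y = 0" and "(x, 0) \<in> carrier G" using v sub by blast+
          then show "\<exists>i. (x, y) = el (int i * int p) 0 \<and> i < p"
            using carrier_coordinates(2,9)[of x 0] p_multiple_coordinates[of x 0] u[OF xy]
            by (intro exI[of _ "nat (x div int p)"]) simp
        qed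
      qed (simp add: cB)
      have BI: "(u, 0) \<in> B" if "(u, 0) \<in> carrier G" "int p dvd u" for u
      proof -
        have "(u, 0) = el (int (nat (u div int p)) * int p) 0"
          using p_multiple_coordinates[OF that] carrier_coordinates(9)[OF that(1)] by simp
        then show ?thesis unfolding B using carrier_coordinates(2)[OF that(1)] by blast
      qed
      have Ainj: "x = x'" if "(x, y) \<in> A" "(x', y) \<in> A" "int p dvd x - x'" for x x' y
      proof -
        have "el (x - x') 0 \<in> carrier G"
          using reduce_in_carrier[of "p^2" q "(x - x', 0)"] by (simp add: reduce_Pair)
        moreover have "int p dvd (x - x') mod int (p^2)" using that(3) by (simp add: dvd_mod)
        ultimately have "el (x - x') 0 \<in> B" using BI by (simp add: residue_pair_def)
        then show ?thesis
          using no_common_difference[OF t that(1,2) _ 0(2)] by (simp add: residue_pair_def)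
      qed
      obtain \<alpha> where \<alpha>: "\<alpha> (0, 0) = 0"
        "\<And>x y. (x, y) \<in> A \<Longrightarrow> \<alpha> (nat (x mod int p), nat y) = x div int p"
      proof -
        have "x div int p = x' div int p" if xy: "(x, y) \<in> A" "(x', y') \<in> A"
          "(nat (x mod int p), nat y) = (nat (x' mod int p), nat y')" for x y x' y'
        proof -
          have "y = y'" using carrier_nat_inj(2)[of x y x' y'] xy sub by blast
          then show ?thesis using Ainj[of x y x'] xy by (simp add: p_dvd_iff_nat_mod)
        qed
        then have "\<exists>\<alpha>. \<alpha> (0, 0) = 0 \<and> (\<forall>x y. (x, y) \<in> A \<longrightarrow> \<alpha> (nat (x mod int p), nat y) = x div int p)"
          by (intro key_function[where key = "\<lambda>x y. (nat (x mod int p), nat y)", OF 0(1)])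
            (simp, simp, blast)
        then show thesis using that by blast
      qed
      have "A = {el (int i + \<alpha> (i, j) * int p) (int j) | i j. i < p \<and> j < q}"
      proof (rule eq_family2I)
        show "A \<subseteq> {el (int i + \<alpha> (i, j) * int p) (int j) | i j. i < p \<and> j < q}"
        proof clarify
          fix x y assume xy: "(x, y) \<in> A"
          then show "\<exists>i j. (x, y) = el (int i + \<alpha> (i, j) * int p) (int j) \<and> i < p \<and> j < q"
            using sub \<alpha>(2)[OF xy] carrier_coordinates[of x y]
            by (intro exI[of _ "nat (x mod int p)"] exI[of _ "nat y"]) auto
        qed
      qed (simp add: card)
      with \<alpha>(1) B show ?thesis by (intro disjI2 exI[of _ "\<lambda>i j. \<alpha> (i, j)"]) simp
    next
      case False
      then obtain u1 v1 where uv1: "(u1, v1) \<in> B" "v1 \<noteq> 0" by blast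
      then have u1: "u1 \<noteq> 0" using Binj[of u1 v1 0] 0(2) by blast
      have Ainj: "x = x'" if "(x, y) \<in> A" "(x', y') \<in> A" "int p dvd x - x'" for x y x' y'
      proof (rule ccontr)
        assume "x \<noteq> x'"
        then show False
          using P_difference_conflict[OF t' qB uv1(1) 0(2) that(1,2)] u[OF uv1(1)] uv1(2) u1 that(3) by simp
      qed
      have "x div int p = x' div int p"
        if "(x, y) \<in> A" "(x', y') \<in> A" "nat (x mod int p) = nat (x' mod int p)" for x y x' y'
        using Ainj[unfolded p_dvd_iff_nat_mod, OF that] by simp
      then have "\<exists>\<alpha>. \<alpha> 0 = 0 \<and> (\<forall>x y. (x, y) \<in> A \<longrightarrow> \<alpha> (nat (x mod int p)) = x div int p)"
        by (intro key_function[where key = "\<lambda>x y. nat (x mod int p)", OF 0(1)])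
          (simp, simp, blast)
      then obtain \<alpha> where \<alpha>: "\<alpha> 0 = 0" "\<And>x y. (x, y) \<in> A \<Longrightarrow> \<alpha> (nat (x mod int p)) = x div int p"
        by blast
      have "A = {el (int i + \<alpha> i * int p) (int j) | i j. i < p \<and> j < q}"
      proof (rule eq_family2I)
        show "A \<subseteq> {el (int i + \<alpha> i * int p) (int j) | i j. i < p \<and> j < q}"
        proof clarify
          fix x y assume xy: "(x, y) \<in> A"
          then show "\<exists>i j. (x, y) = el (int i + \<alpha> i * int p) (int j) \<and> i < p \<and> j < q"
            using sub \<alpha>(2)[OF xy] carrier_coordinates[of x y]
            by (intro exI[of _ "nat (x mod int p)"] exI[of _ "nat y"]) auto
        qed
      qed (simp add: card)
      with \<alpha> lam B show ?thesis by blast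
    qed
  qed
qed

section \<open>The listed pairs are tilings\<close>

lemma residue_pair_add: "reduce (p^2) q (el a b + el c d) = el (a + c) (b + d)"
  by (simp add: residue_pair_def reduce_def mod_add_eq)

lemma nat_residue_ex: "m > 0 \<Longrightarrow> \<exists>i < m. [int i = x] (mod int m)"
  by (intro exI[of _ "nat (x mod int m)"]) (auto simp: cong_def nat_less_iff)

lemma p_multiple_ex:
  assumes "[x = z] (mod int p)"
  shows "\<exists>j < p. [z + int j * int p = x] (mod int (p^2))"
proof -
  obtain w where w: "x = z + int p * w" using assms by (metis cong_iff_lin cong_sym)
  obtain j where j: "j < p" "[int j = w] (mod int p)" using nat_residue_ex[of p w] by auto
  have "[int j * int p = w * int p] (mod int p * int p)"
    using j(2) by (simp add: cong_iff_dvd_diff flip: left_diff_distrib)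
  then have "[z + int j * int p = z + w * int p] (mod int p * int p)"
    by (rule cong_add[OF cong_refl])
  then show ?thesis using j(1) w by (auto simp: power2_eq_square mult.commute)
qed

text \<open>By cardinality, covering suffices.  In the seven cases below, the class of one coordinate modulo \<open>p\<close>,
  \<open>q\<close> or \<open>p\<^sup>2\<close> determines the first index \<open>i\<close> of the element of \<open>A\<close>, and the remaining
  parameters correct what is left.\<close>

lemma tiling_familiesI:
  assumes "A \<subseteq> carrier G" "B \<subseteq> carrier G" "card A \<le> m" "card B \<le> n" "m * n = p^2 * q"
    and "\<And>x y. \<exists>a b c d. el a b \<in> A \<and> el c d \<in> B
           \<and> [a + c = x] (mod int (p^2)) \<and> [b + d = y] (mod int q)"
  shows "tiling A B"
proof (rule tilingI)
  show "card A * card B \<le> p^2 * q" using assms(3-5) mult_le_mono by metis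
  fix x y
  show "\<exists>a\<in>A. \<exists>b\<in>B. reduce (p^2) q (a + b) = el x y"
  proof -
    obtain a b c d where "el a b \<in> A" "el c d \<in> B"
      "[a + c = x] (mod int (p^2))" "[b + d = y] (mod int q)" using assms(6)[of x y] by blast
    then show ?thesis
      using residue_pair_add[of a b c d] residue_pair_eq_iff[of "p^2" q "a + c" "b + d" x y] by force
  qed
qed (use assms in auto)

lemma tiling_by_subgroup_order_pq:
  assumes "A \<subseteq> carrier G" "B \<subseteq> carrier G"
    and A: "A = {el (int i + \<alpha> i * int p) (\<alpha> i) | i. i < p}"
    and B: "B = {el (int i * int p) (int j) | i j. i < p \<and> j < q}"
  shows "tiling A B"
proof (rule tiling_familiesI)
  show "card A \<le> p" "card B \<le> p * q" unfolding A B
    by (rule family_finite_card_le family2_finite_card_le)+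
  fix x y
  obtain i where i: "i < p" "[int i = x] (mod int p)" using nat_residue_ex[of p x] by auto
  then have "[x = int i + \<alpha> i * int p] (mod int p)" by (simp add: cong_def)
  then obtain k where k: "k < p" "[int i + \<alpha> i * int p + int k * int p = x] (mod int (p^2))"
    using p_multiple_ex by blast
  obtain j where j: "j < q" "[int j = y - \<alpha> i] (mod int q)" using nat_residue_ex[of q] pos(2) by blast
  have "[\<alpha> i + int j = y] (mod int q)" using j(2) by (simp add: cong_iff_dvd_diff algebra_simps)
  then show "\<exists>a b c d. el a b \<in> A \<and> el c d \<in> B
           \<and> [a + c = x] (mod int (p^2)) \<and> [b + d = y] (mod int q)"
    unfolding A B using i j k by blast
qed (use assms in \<open>auto simp: power2_eq_square\<close>)

lemma tiling_by_subgroup_order_p2: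
  assumes "A \<subseteq> carrier G" "B \<subseteq> carrier G"
    and A: "A = {el (\<alpha> i) (int i) | i. i < q}"
    and B: "B = {el (int i) 0 | i. i < p^2}"
  shows "tiling A B"
proof (rule tiling_familiesI)
  show "card A \<le> q" "card B \<le> p^2" unfolding A B
    by (rule family_finite_card_le)+
  fix x y
  obtain i where i: "i < q" "[int i + 0 = y] (mod int q)" using nat_residue_ex[of q y] by auto
  obtain j where j: "j < p^2" "[int j = x - \<alpha> i] (mod int (p^2))" using nat_residue_ex[of "p^2"] pos(3) by blast
  have "[\<alpha> i + int j = x] (mod int (p^2))" using j(2) by (simp add: cong_iff_dvd_diff algebra_simps)
  then show "\<exists>a b c d. el a b \<in> A \<and> el c d \<in> B
           \<and> [a + c = x] (mod int (p^2)) \<and> [b + d = y] (mod int q)"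
    unfolding A B using i j by blast
qed (use assms in \<open>auto simp: mult.commute\<close>)

lemma tiling_P_periodic_by_graph_over_Zq:
  assumes "A \<subseteq> carrier G" "B \<subseteq> carrier G"
    and A: "A = {el (int i + int j * int p) (\<alpha> i) | i j. i < p \<and> j < p}"
    and B: "B = {el (lam i * int p) (int i) | i. i < q}"
  shows "tiling A B"
proof (rule tiling_familiesI)
  show "card A \<le> p * p" "card B \<le> q" unfolding A B
    by (rule family_finite_card_le family2_finite_card_le)+
  fix x y
  obtain i where i: "i < p" "[int i = x] (mod int p)" using nat_residue_ex[of p x] by auto
  obtain k where k: "k < q" "[int k = y - \<alpha> i] (mod int q)" using nat_residue_ex[of q] pos(2) by blast
  have y: "[\<alpha> i + int k = y] (mod int q)" using k(2) by (simp add: cong_iff_dvd_diff algebra_simps)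
  have "[x = int i + lam k * int p] (mod int p)" using i by (simp add: cong_def)
  then obtain j where j: "j < p" "[int i + lam k * int p + int j * int p = x] (mod int (p^2))"
    using p_multiple_ex by blast
  then have "[int i + int j * int p + lam k * int p = x] (mod int (p^2))" by (simp add: ac_simps)
  then show "\<exists>a b c d. el a b \<in> A \<and> el c d \<in> B
           \<and> [a + c = x] (mod int (p^2)) \<and> [b + d = y] (mod int q)"
    unfolding A B using i j k y by blast
qed (use assms in \<open>auto simp: power2_eq_square\<close>)

lemma tiling_by_subgroup_order_q:
  assumes "A \<subseteq> carrier G" "B \<subseteq> carrier G"
    and A: "A = {el (int i) (\<alpha> i) | i. i < p^2}"
    and B: "B = {el 0 (int i) | i. i < q}"
  shows "tiling A B"
proof (rule tiling_familiesI)
  show "card A \<le> p^2" "card B \<le> q" unfolding A B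
    by (rule family_finite_card_le)+
  fix x y
  obtain i where i: "i < p^2" "[int i + 0 = x] (mod int (p^2))" using nat_residue_ex[of "p^2" x] by auto
  obtain j where j: "j < q" "[int j = y - \<alpha> i] (mod int q)" using nat_residue_ex[of q] pos(2) by blast
  have "[\<alpha> i + int j = y] (mod int q)" using j(2) by (simp add: cong_iff_dvd_diff algebra_simps)
  then show "\<exists>a b c d. el a b \<in> A \<and> el c d \<in> B
           \<and> [a + c = x] (mod int (p^2)) \<and> [b + d = y] (mod int q)"
    unfolding A B using i j by blast
qed (use assms in auto)

lemma tiling_Zq_periodic_by_graph_over_P:
  assumes "A \<subseteq> carrier G" "B \<subseteq> carrier G"
    and A: "A = {el (int i + \<alpha> i * int p) (int j) | i j. i < p \<and> j < q}"
    and B: "B = {el (int i * int p) (lam i) | i. i < p}"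
  shows "tiling A B"
proof (rule tiling_familiesI)
  show "card A \<le> p * q" "card B \<le> p" unfolding A B
    by (rule family_finite_card_le family2_finite_card_le)+
  fix x y
  obtain i where i: "i < p" "[int i = x] (mod int p)" using nat_residue_ex[of p x] by auto
  then have "[x = int i + \<alpha> i * int p] (mod int p)" by (simp add: cong_def)
  then obtain k where k: "k < p" "[int i + \<alpha> i * int p + int k * int p = x] (mod int (p^2))"
    using p_multiple_ex by blast
  obtain j where j: "j < q" "[int j = y - lam k] (mod int q)" using nat_residue_ex[of q] pos(2) by blast
  have "[int j + lam k = y] (mod int q)" using j(2) by (simp add: cong_iff_dvd_diff algebra_simps)
  then show "\<exists>a b c d. el a b \<in> A \<and> el c d \<in> B
           \<and> [a + c = x] (mod int (p^2)) \<and> [b + d = y] (mod int q)"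
    unfolding A B using i j k by blast
qed (use assms in \<open>auto simp: power2_eq_square\<close>)

lemma tiling_P_periodic_by_transversal:
  assumes "A \<subseteq> carrier G" "B \<subseteq> carrier G"
    and A: "A = {el (\<alpha> i + int j * int p) (int i) | i j. i < q \<and> j < p}"
    and B: "B = {el (int i + lam i * int p) 0 | i. i < p}"
  shows "tiling A B"
proof (rule tiling_familiesI)
  show "card A \<le> q * p" "card B \<le> p" unfolding A B
    by (rule family_finite_card_le family2_finite_card_le)+
  fix x y
  obtain i where i: "i < q" "[int i + 0 = y] (mod int q)" using nat_residue_ex[of q y] by auto
  obtain k where k: "k < p" "[int k = x - \<alpha> i] (mod int p)" using nat_residue_ex[of p] pos(1) by blast
  have "[int k + \<alpha> i = x] (mod int p)" using k(2) by (simp add: cong_iff_dvd_diff algebra_simps)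
  then have "[x = \<alpha> i + int k] (mod int p)" by (simp add: cong_sym_eq add.commute)
  then have "[x = \<alpha> i + int k + lam k * int p] (mod int p)" by (simp add: cong_def)
  then obtain j where j: "j < p" "[\<alpha> i + int k + lam k * int p + int j * int p = x] (mod int (p^2))"
    using p_multiple_ex by blast
  then have "[\<alpha> i + int j * int p + (int k + lam k * int p) = x] (mod int (p^2))" by (simp add: ac_simps)
  then show "\<exists>a b c d. el a b \<in> A \<and> el c d \<in> B
           \<and> [a + c = x] (mod int (p^2)) \<and> [b + d = y] (mod int q)"
    unfolding A B using i j k by blast
qed (use assms in \<open>auto simp: power2_eq_square\<close>)

lemma tiling_by_subgroup_order_p:
  assumes "A \<subseteq> carrier G" "B \<subseteq> carrier G"
    and A: "A = {el (int i + \<alpha> i j * int p) (int j) | i j. i < p \<and> j < q}"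
    and B: "B = {el (int i * int p) 0 | i. i < p}"
  shows "tiling A B"
proof (rule tiling_familiesI)
  show "card A \<le> p * q" "card B \<le> p" unfolding A B
    by (rule family_finite_card_le family2_finite_card_le)+
  fix x y
  obtain i where i: "i < p" "[int i = x] (mod int p)" using nat_residue_ex[of p x] by auto
  obtain j where j: "j < q" "[int j + 0 = y] (mod int q)" using nat_residue_ex[of q y] by auto
  have "[x = int i + \<alpha> i j * int p] (mod int p)" using i by (simp add: cong_def)
  then obtain k where k: "k < p" "[int i + \<alpha> i j * int p + int k * int p = x] (mod int (p^2))"
    using p_multiple_ex by blast
  then show "\<exists>a b c d. el a b \<in> A \<and> el c d \<in> B
           \<and> [a + c = x] (mod int (p^2)) \<and> [b + d = y] (mod int q)"
    unfolding A B using i j by blast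
qed (use assms in \<open>auto simp: power2_eq_square\<close>)

section \<open>The classification\<close>

lemma tile_card_cases:
  assumes t: "tiling A B"
  shows "card A \<in> {1, p, p^2, q, p * q, p^2 * q}"
proof -
  have "card A dvd p^2 * q" using card_tiles[OF t] by (metis dvd_triv_left)
  then obtain b c where bc: "card A = b * c" "b dvd p^2" "c dvd q"
    using division_decomp by blast
  obtain i where "i \<le> 2" "b = p^i" using bc(2) divides_primepow_nat[OF p] by blast
  moreover have "c = 1 \<or> c = q" using bc(3) q by (simp add: prime_nat_iff)
  moreover have "i = 0 \<or> i = 1 \<or> i = 2" using \<open>i \<le> 2\<close> by linarith
  ultimately show ?thesis using bc(1) by auto
qed

end

theorem theorem5p4:
  fixes p q :: nat and S C :: "(int \<times> int) set"
  assumes "prime p" and "prime q" and "p \<noteq> q"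
    and "S \<subset> carrier (ZxZ (p^2) q) - {\<one>\<^bsub>ZxZ (p^2) q\<^esub>}"
    and "generate (ZxZ (p^2) q) S = carrier (ZxZ (p^2) q)"
    and "\<one>\<^bsub>ZxZ (p^2) q\<^esub> \<in> C" and "C \<subseteq> carrier (ZxZ (p^2) q)"
  shows "perfect_code (with_proj (Cay (ZxZ (p^2) q) S)) C \<longleftrightarrow>
    (let S0 = S \<union> {\<one>\<^bsub>ZxZ (p^2) q\<^esub>}; el = residue_pair (p^2) q in
      (\<exists>\<alpha> :: nat \<Rightarrow> int. \<alpha> 0 = 0 \<and>
        S0 = {el (int i + \<alpha> i * int p) (\<alpha> i) | i. i < p} \<and>
        C = {el (int i * int p) (int j) | i j. i < p \<and> j < q})
    \<or> (\<exists>\<alpha> :: nat \<Rightarrow> int. \<alpha> 0 = 0 \<and>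
        S0 = {el (\<alpha> i) (int i) | i. i < q} \<and>
        C = {el (int i) 0 | i. i < p^2})
    \<or> (\<exists>\<alpha> lam :: nat \<Rightarrow> int. \<alpha> 0 = 0 \<and> lam 0 = 0 \<and>
        S0 = {el (int i + int j * int p) (\<alpha> i) | i j. i < p \<and> j < p} \<and>
        C = {el (lam i * int p) (int i) | i. i < q})
    \<or> (\<exists>\<alpha> :: nat \<Rightarrow> int. \<alpha> 0 = 0 \<and>
        S0 = {el (int i) (\<alpha> i) | i. i < p^2} \<and>
        C = {el 0 (int i) | i. i < q})
    \<or> (\<exists>\<alpha> lam :: nat \<Rightarrow> int. \<alpha> 0 = 0 \<and> lam 0 = 0 \<and>
        S0 = {el (int i + \<alpha> i * int p) (int j) | i j. i < p \<and> j < q} \<and>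
        C = {el (int i * int p) (lam i) | i. i < p})
    \<or> (\<exists>\<alpha> lam :: nat \<Rightarrow> int. \<alpha> 0 = 0 \<and> lam 0 = 0 \<and>
        S0 = {el (\<alpha> i + int j * int p) (int i) | i j. i < q \<and> j < p} \<and>
        C = {el (int i + lam i * int p) 0 | i. i < p})
    \<or> (\<exists>\<alpha> :: nat \<Rightarrow> nat \<Rightarrow> int. \<alpha> 0 0 = 0 \<and>
        S0 = {el (int i + \<alpha> i j * int p) (int j) | i j. i < p \<and> j < q} \<and>
        C = {el (int i * int p) 0 | i. i < p}))"
proof -
  interpret distinct_primes p q by unfold_locales (rule assms(1-3))+
  define A where "A = S \<union> {\<one>\<^bsub>G\<^esub>}"
  have A0: "A = S \<union> {(0, 0)}" by (simp add: A_def one_ZxZ)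
  have S: "S \<subseteq> carrier G" "(0, 0) \<notin> S" using assms(4) by (auto simp: one_ZxZ)
  have "(0, 0) \<in> carrier G" by (simp add: carrier_G)
  have AG: "A \<subseteq> carrier G" and ne: "A \<noteq> carrier G"
    using assms(4) S \<open>(0, 0) \<in> carrier G\<close> by (auto simp: A0 one_ZxZ)
  have gen: "generic A" using generating_set_generic[OF S(1) assms(5)] by (simp add: A0)
  have 0: "(0, 0) \<in> A" "(0, 0) \<in> C" using assms(6) by (auto simp: A0 one_ZxZ)
  have code: "perfect_code (with_proj (Cay G S)) C \<longleftrightarrow> tiling A C"
    using perfect_code_Cay_iff[of "p^2" q S C] S assms(7) AG by (simp add: tiling_def A_def)
  show ?thesis
    unfolding Let_def A_def[symmetric] code
  proof (rule iffI, goal_cases)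
    case t: 1
    have "card A \<noteq> 1" using gen by (auto simp: generic_def card_1_singleton_iff)
    moreover have "card A \<noteq> p^2 * q"
      using card_subset_eq[OF finite_carrier_G AG] ne by (auto simp: card_G)
    ultimately consider "card A = p" | "card A = q" | "card A = p^2" | "card A = p * q"
      using tile_card_cases[OF t] by blast
    then show ?case
    proof cases
      case 1
      from tiling_card_p[OF t gen 0 1] show ?thesis by (rule disjI1)
    next
      case 2
      from tiling_card_q[OF t gen 0 2] show ?thesis by (intro disjI2[OF disjI1])
    next
      case 3
      from tiling_card_p2[OF t gen 0 3] show ?thesis by argo
    next
      case 4
      from tiling_card_pq[OF t gen 0 4] show ?thesis by argo
    qed
  next
    case 2
    then show ?case
    proof (elim disjE exE conjE)
    qed (rule tiling_by_subgroup_order_pq[OF AG assms(7)] tiling_by_subgroup_order_p2[OF AG assms(7)] tiling_P_periodic_by_graph_over_Zq[OF AG assms(7)]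
        tiling_by_subgroup_order_q[OF AG assms(7)] tiling_Zq_periodic_by_graph_over_P[OF AG assms(7)] tiling_P_periodic_by_transversal[OF AG assms(7)]
        tiling_by_subgroup_order_p[OF AG assms(7)]; assumption)+
  qed
qed

end
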